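(* Let $p\ge 2$, $m\ge 1$, $d\ge1$, $n\ge1$. Let $\sigma:\mathbb{R}\to\mathbb{R}$ be one of: (a) a piecewise-polynomial activation with at most $L\ge1$ pieces and maximal piece degree $r\ge1$; (b) a trigonometric polynomial of degree at most $K$; (c) a polynomial–rational–exponential activation. Let $\mathcal{H}_\sigma=\{h_\theta:\ \theta=(W,V)\in\mathbb{R}^{d\times p}\times\mathbb{R}^{p\times d}\}$ where $h_\theta$ is the predictor induced by the scores $s^\theta(x)=V\sigma(Wx)$. Then for every $\delta\in(0,1)$, with probability at least $1-\delta$ over the draw of $\mathcal{D}_{\mathrm{train}}=\{(x^{(i)},y^{(i)})\}_{i=1}^n\sim\mathcal{D}_m^n$, \[ \sup_{h\in\mathcal{H}_\sigma}\Big|\mathbb{P}_{(X,Y)\sim\mathcal{D}_m}[h(X)\ne Y]-\frac1n\sum_{i=1}^n\mathbf{1}\{h(x^{(i)})\ne y^{(i)}\}\Big|\ \le\ \widetilde{\mathcal{O}}\!\left(\sqrt{\frac{dp+\log(1/\delta)}{n}}\right). \]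
   Context: Let $[p]=\{0,\dots,p-1\}$, $e_r$ the standard basis of $\mathbb{R}^p$, $\mathcal{X}_m=\{x\in\{0,\dots,m\}^p:\|x\|_1=m\}$. $\mathcal{D}_m$ is the law of $(X,Y)$ with $s_1,\dots,s_m$ i.i.d. uniform on $[p]$, $X=\sum_i e_{s_i}$, $Y=(\sum_i s_i)\bmod p$; $\mathcal{D}_m^n$ denotes $n$ i.i.d. draws. $\sigma$ is applied entrywise. The predictor is $h_\theta(x)=\ell$ if $s^\theta_\ell(x)>s^\theta_k(x)$ for all $k\ne\ell$, and $h_\theta(x)=\bot$ (counted as an error) otherwise. Activation families: (a) piecewise polynomial: there are breakpoints $-\infty=b_0<b_1<\dots<b_L=+\infty$ and polynomials $P_1,\dots,P_L$ of degree $\le r$ with $\sigma(t)=P_\ell(t)$ on $(b_{\ell-1},b_\ell]$; (b) trigonometric polynomial: $\sigma(t)=a_0+\sum_{k=1}^K(a_k\cos(kt)+b_k\sin(kt))$ with real coefficients; (c) polynomial–rational–exponential: $\sigma(t)=P(t)\frac{ae^{kt}+b}{ce^{kt}+\tau}$ with fixed $k\in\mathbb{R}\setminus\{0\}$, $c\ge0$, $\tau>0$, $a,b\in\mathbb{R}$ and a real polynomial $P$. Notation: $f=\widetilde{\mathcal{O}}(g)$ means $f\le C\cdot g$ up to an absolute constant (independent of the architecture and data, but allowed to depend on the fixed activation) and polylogarithmic factors (in the problem parameters $d,p,m,n,1/\delta$). *)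

theory Defs
  imports "HOL-Analysis.Analysis" "HOL-Probability.Probability"
    "HOL-Computational_Algebra.Polynomial"
begin

definition data_X :: "nat \<Rightarrow> (nat \<Rightarrow> nat) \<Rightarrow> (nat \<Rightarrow> nat)" where
  "data_X m s = (\<lambda>k. card {i. i < m \<and> s i = k})"

definition data_Y :: "nat \<Rightarrow> nat \<Rightarrow> (nat \<Rightarrow> nat) \<Rightarrow> nat" where
  "data_Y p m s = (\<Sum>i<m. s i) mod p"

definition D_m :: "nat \<Rightarrow> nat \<Rightarrow> ((nat \<Rightarrow> nat) \<times> nat) pmf" where
  "D_m p m = map_pmf (\<lambda>s. (data_X m s, data_Y p m s))
              (pmf_of_set (PiE {..<m} (\<lambda>_. {..<p})))"

definition D_m_n :: "nat \<Rightarrow> nat \<Rightarrow> nat \<Rightarrow> (nat \<Rightarrow> ((nat \<Rightarrow> nat) \<times> nat)) pmf" where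
  "D_m_n p m n = Pi_pmf {..<n} undefined (\<lambda>_. D_m p m)"

definition score :: "(real \<Rightarrow> real) \<Rightarrow> nat \<Rightarrow> nat \<Rightarrow> (nat \<Rightarrow> nat \<Rightarrow> real) \<Rightarrow>
    (nat \<Rightarrow> nat \<Rightarrow> real) \<Rightarrow> (nat \<Rightarrow> nat) \<Rightarrow> nat \<Rightarrow> real" where
  "score \<sigma> p d W V x l = (\<Sum>j<d. V l j * \<sigma> (\<Sum>k<p. W j k * real (x k)))"

definition predictor :: "(real \<Rightarrow> real) \<Rightarrow> nat \<Rightarrow> nat \<Rightarrow> (nat \<Rightarrow> nat \<Rightarrow> real) \<Rightarrow>
    (nat \<Rightarrow> nat \<Rightarrow> real) \<Rightarrow> (nat \<Rightarrow> nat) \<Rightarrow> nat option" where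
  "predictor \<sigma> p d W V x =
     (if \<exists>l<p. \<forall>k<p. k \<noteq> l \<longrightarrow> score \<sigma> p d W V x l > score \<sigma> p d W V x k
      then Some (THE l. l < p \<and> (\<forall>k<p. k \<noteq> l \<longrightarrow> score \<sigma> p d W V x l > score \<sigma> p d W V x k))
      else None)"

(* (a) piecewise polynomial with L pieces of degree <= r:
   breakpoints b_1 < ... < b_{L-1}, b_0 = -inf, b_L = +inf,
   sigma = P_l on (b_{l-1}, b_l] *)
definition piecewise_poly_act :: "nat \<Rightarrow> nat \<Rightarrow> (real \<Rightarrow> real) \<Rightarrow> bool" where
  "piecewise_poly_act L r \<sigma> \<longleftrightarrow>
     (\<exists>(b :: nat \<Rightarrow> real) (P :: nat \<Rightarrow> real poly).
        (\<forall>l. 1 \<le> l \<and> l + 1 < L \<longrightarrow> b l < b (l + 1)) \<and>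
        (\<forall>l\<in>{1..L}. degree (P l) \<le> r) \<and>
        (\<forall>l\<in>{1..L}. \<forall>t. (l = 1 \<or> b (l - 1) < t) \<and> (l = L \<or> t \<le> b l)
              \<longrightarrow> \<sigma> t = poly (P l) t))"

definition trig_poly_act :: "nat \<Rightarrow> (real \<Rightarrow> real) \<Rightarrow> bool" where
  "trig_poly_act K \<sigma> \<longleftrightarrow>
     (\<exists>a0 (a :: nat \<Rightarrow> real) (b :: nat \<Rightarrow> real).
        \<forall>t. \<sigma> t = a0 + (\<Sum>k=1..K. a k * cos (real k * t) + b k * sin (real k * t)))"

definition pre_act :: "(real \<Rightarrow> real) \<Rightarrow> bool" where
  "pre_act \<sigma> \<longleftrightarrow>
     (\<exists>(k::real) (c::real) (\<tau>::real) (a::real) (b::real) (P :: real poly).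
        k \<noteq> 0 \<and> c \<ge> 0 \<and> \<tau> > 0 \<and>
        (\<forall>t. \<sigma> t = poly P t * ((a * exp (k * t) + b) / (c * exp (k * t) + \<tau>))))"

end

theory Submission
  imports Defs "HOL-Probability.Hoeffding"
begin

text \<open>
  On a fixed finite set of inputs the predictor depends only on the signs of the score differences.
  After a reparametrization these are signs of polynomials in $O(dp)$ variables: for piecewise
  polynomial activations once the pieces hit by the preactivations are fixed (itself a sign pattern
  of linear forms); for trigonometric ones in the variables $\cos W_{ji}, \sin W_{ji}$, because inputs
  have integer entries; for polynomial-rational-exponential ones in $W_{ji}$ and $e^{kW_{ji}}$, after
  clearing the positive denominators.

  The number of sign patterns is bounded by a Warren-type argument that needs neither Bezout's nor
  Sard's theorem. For each pattern and each small vector $c$, the product of the squares of the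
  polynomials, cut off by a box and tilted by $c$, has an interior maximum in the cell of that
  pattern, so the equations $\nabla G = c$ have a solution in every cell. The products
  $(\nabla G)^a \lambda^b$, with $\lambda$ a linear form, outnumber the monomials of the same
  degree, hence are linearly dependent; for generic $c$ this gives a nonzero polynomial of small degree
  in one variable with a root $\lambda(x)$ for each cell.

  Symmetrization in its moment generating function form turns the resulting bound on the growth
  function into uniform convergence.
\<close>

section \<open>Polynomial functions of bounded degree in each variable\<close>

text \<open>The degree is bounded in each variable separately, not in total: the exponent vectors
  then form a product set of exactly \<open>(D + 1) ^ card I\<close> elements, and the bounds add
  under multiplication. The members are functions rather than formal polynomials, so parameters are
  substituted by plain application; coordinates outside \<open>I\<close> have no influence.\<close>

definition poly_fun :: "'v set \<Rightarrow> nat \<Rightarrow> (('v \<Rightarrow> real) \<Rightarrow> real) set" where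
  "poly_fun I D = {f. \<exists>c. \<forall>x. f x = (\<Sum>a\<in>PiE I (\<lambda>_. {..D}). c a * (\<Prod>i\<in>I. x i ^ a i))}"

lemma poly_fun_cong:
  assumes "f \<in> poly_fun I D" "\<And>x. f x = g x"
  shows "g \<in> poly_fun I D"
  using assms unfolding poly_fun_def by auto

lemma poly_fun_add:
  assumes "f \<in> poly_fun I D" "g \<in> poly_fun I D"
  shows "(\<lambda>x. f x + g x) \<in> poly_fun I D"
proof -
  from assms obtain c e where
    "\<And>x. f x = (\<Sum>a\<in>PiE I (\<lambda>_. {..D}). c a * (\<Prod>i\<in>I. x i ^ a i))"
    "\<And>x. g x = (\<Sum>a\<in>PiE I (\<lambda>_. {..D}). e a * (\<Prod>i\<in>I. x i ^ a i))"
    unfolding poly_fun_def by auto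
  then have "f x + g x = (\<Sum>a\<in>PiE I (\<lambda>_. {..D}). (c a + e a) * (\<Prod>i\<in>I. x i ^ a i))" for x
    by (simp add: distrib_right sum.distrib)
  then show ?thesis unfolding poly_fun_def by (intro CollectI exI) auto
qed

lemma poly_fun_scale:
  assumes "f \<in> poly_fun I D"
  shows "(\<lambda>x. r * f x) \<in> poly_fun I D"
proof -
  from assms obtain c where
    "\<And>x. f x = (\<Sum>a\<in>PiE I (\<lambda>_. {..D}). c a * (\<Prod>i\<in>I. x i ^ a i))"
    unfolding poly_fun_def by auto
  then have "r * f x = (\<Sum>a\<in>PiE I (\<lambda>_. {..D}). (r * c a) * (\<Prod>i\<in>I. x i ^ a i))" for x
    by (simp add: sum_distrib_left mult.assoc)
  then show ?thesis unfolding poly_fun_def by (intro CollectI exI) auto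
qed

lemma poly_fun_zero: "(\<lambda>x. 0) \<in> poly_fun I D"
  unfolding poly_fun_def by (intro CollectI exI[of _ "\<lambda>_. 0"]) auto

lemma poly_fun_sum:
  assumes "\<And>a. a \<in> A \<Longrightarrow> f a \<in> poly_fun I D"
  shows "(\<lambda>x. \<Sum>a\<in>A. f a x) \<in> poly_fun I D"
  using assms
proof (induction A rule: infinite_finite_induct)
  case (insert a A)
  have "(\<lambda>x. f a x + (\<Sum>a\<in>A. f a x)) \<in> poly_fun I D"
    by (rule poly_fun_add) (use insert in auto)
  then show ?case using insert.hyps by simp
qed (auto simp: poly_fun_zero)

lemma poly_fun_uminus:
  assumes "f \<in> poly_fun I D"
  shows "(\<lambda>x. - f x) \<in> poly_fun I D"
  using poly_fun_scale[OF assms, of "-1"] by simp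

lemma poly_fun_diff:
  assumes "f \<in> poly_fun I D" "g \<in> poly_fun I D"
  shows "(\<lambda>x. f x - g x) \<in> poly_fun I D"
  using poly_fun_add[OF assms(1) poly_fun_uminus[OF assms(2)]] by simp

context
  fixes I :: "'v set"
  assumes fin: "finite I"
begin

lemma poly_fun_monomial:
  assumes "\<And>i. i \<in> I \<Longrightarrow> a i \<le> D"
  shows "(\<lambda>x. \<Prod>i\<in>I. x i ^ a i) \<in> poly_fun I D"
proof -
  let ?b = "restrict a I"
  have b: "?b \<in> PiE I (\<lambda>_. {..D})" using assms by auto
  have f: "finite (PiE I (\<lambda>_. {..D}))" using fin by (intro finite_PiE) auto
  have "(\<Prod>i\<in>I. x i ^ a i) =
      (\<Sum>e\<in>PiE I (\<lambda>_. {..D}). (if e = ?b then 1 else 0) * (\<Prod>i\<in>I. x i ^ e i))" for x :: "'v \<Rightarrow> real"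
  proof -
    have "(\<Sum>e\<in>PiE I (\<lambda>_. {..D}). (if e = ?b then 1 else 0) * (\<Prod>i\<in>I. x i ^ e i))
      = (\<Sum>e\<in>PiE I (\<lambda>_. {..D}). (if ?b = e then (\<Prod>i\<in>I. x i ^ e i) else 0))"
      by (intro sum.cong) auto
    also have "\<dots> = (\<Prod>i\<in>I. x i ^ ?b i)" using b f by (subst sum.delta') auto
    also have "\<dots> = (\<Prod>i\<in>I. x i ^ a i)" by (intro prod.cong) auto
    finally show ?thesis ..
  qed
  then show ?thesis unfolding poly_fun_def by (intro CollectI exI) auto
qed

lemma poly_fun_mult:
  assumes "f \<in> poly_fun I D" "g \<in> poly_fun I E"
  shows "(\<lambda>x. f x * g x) \<in> poly_fun I (D + E)"
proof -
  from assms obtain c e where *: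
    "\<And>x. f x = (\<Sum>a\<in>PiE I (\<lambda>_. {..D}). c a * (\<Prod>i\<in>I. x i ^ a i))"
    "\<And>x. g x = (\<Sum>a\<in>PiE I (\<lambda>_. {..E}). e a * (\<Prod>i\<in>I. x i ^ a i))"
    unfolding poly_fun_def by auto
  have "(\<lambda>x. \<Sum>a\<in>PiE I (\<lambda>_. {..D}). \<Sum>b\<in>PiE I (\<lambda>_. {..E}).
           (c a * e b) * (\<Prod>i\<in>I. x i ^ (a i + b i))) \<in> poly_fun I (D + E)"
    by (intro poly_fun_sum poly_fun_scale poly_fun_monomial add_mono) (auto simp: PiE_iff)
  moreover have "(\<Sum>a\<in>PiE I (\<lambda>_. {..D}). \<Sum>b\<in>PiE I (\<lambda>_. {..E}).
           (c a * e b) * (\<Prod>i\<in>I. x i ^ (a i + b i))) = f x * g x" for x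
    unfolding * sum_product by (intro sum.cong) (auto simp: power_add prod.distrib)
  ultimately show ?thesis by (rule poly_fun_cong)
qed

lemma poly_fun_mono:
  assumes "f \<in> poly_fun I D" "D \<le> E"
  shows "f \<in> poly_fun I E"
proof -
  from assms obtain c where *:
    "\<And>x. f x = (\<Sum>a\<in>PiE I (\<lambda>_. {..D}). c a * (\<Prod>i\<in>I. x i ^ a i))"
    unfolding poly_fun_def by auto
  have "(\<lambda>x. \<Sum>a\<in>PiE I (\<lambda>_. {..D}). c a * (\<Prod>i\<in>I. x i ^ a i)) \<in> poly_fun I E"
    using assms(2) by (intro poly_fun_sum poly_fun_scale poly_fun_monomial) (auto simp: PiE_iff intro: order_trans)
  then show ?thesis by (rule poly_fun_cong) (simp add: *)
qed

lemma poly_fun_const: "(\<lambda>x. c) \<in> poly_fun I D"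
  using poly_fun_scale[OF poly_fun_monomial[of "\<lambda>_. 0" D], of c] by simp

lemma poly_fun_var:
  assumes "i \<in> I" "1 \<le> D"
  shows "(\<lambda>x. x i) \<in> poly_fun I D"
proof -
  have "(\<lambda>x. \<Prod>k\<in>I. x k ^ (if k = i then 1 else 0)) \<in> poly_fun I D"
    by (rule poly_fun_monomial) (use assms in auto)
  moreover have "(\<Prod>k\<in>I. x k ^ (if k = i then 1 else 0)) = x i" for x :: "'v \<Rightarrow> real"
  proof -
    have "(\<Prod>k\<in>I. x k ^ (if k = i then 1 else 0)) = (\<Prod>k\<in>I. if k = i then x k else 1)"
      by (intro prod.cong) auto
    then show ?thesis using fin assms by (simp add: prod.delta)
  qed
  ultimately show ?thesis by (rule poly_fun_cong)
qed

lemma poly_fun_prod: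
  assumes "\<And>a. a \<in> A \<Longrightarrow> f a \<in> poly_fun I (D a)"
  shows "(\<lambda>x. \<Prod>a\<in>A. f a x) \<in> poly_fun I (\<Sum>a\<in>A. D a)"
  using assms
proof (induction A rule: infinite_finite_induct)
  case (insert a A)
  have "(\<lambda>x. f a x * (\<Prod>a\<in>A. f a x)) \<in> poly_fun I (D a + (\<Sum>a\<in>A. D a))"
    by (rule poly_fun_mult) (use insert in auto)
  then show ?case using insert.hyps by simp
qed (auto simp: poly_fun_const)

lemma poly_fun_power:
  assumes "f \<in> poly_fun I D"
  shows "(\<lambda>x. f x ^ n) \<in> poly_fun I (n * D)"
  using poly_fun_prod[of "{..<n}" "\<lambda>_. f" "\<lambda>_. D"] assms by simp

lemma poly_fun_poly:
  assumes "f \<in> poly_fun I D"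
  shows "(\<lambda>x. poly p (f x)) \<in> poly_fun I (degree p * D)"
  unfolding poly_altdef
  by (intro poly_fun_sum poly_fun_scale poly_fun_mono[OF poly_fun_power[OF assms]]) auto

lemma poly_fun_deriv:
  assumes f: "f \<in> poly_fun I D" and i: "i \<in> I"
  shows "\<exists>g\<in>poly_fun I D. \<forall>x. ((\<lambda>s. f (x(i:=s))) has_real_derivative g x) (at (x i))"
proof -
  from f obtain c where *:
    "\<And>x. f x = (\<Sum>a\<in>PiE I (\<lambda>_. {..D}). c a * (\<Prod>i\<in>I. x i ^ a i))"
    unfolding poly_fun_def by auto
  \<comment> \<open>For \<open>a i = 0\<close> the truncated exponent \<open>a i - 1\<close> is 0
    instead of -1, but the factor \<open>real (a i)\<close> removes that term.\<close>
  define g where "g x = (\<Sum>a\<in>PiE I (\<lambda>_. {..D}). c a * (real (a i) * (\<Prod>k\<in>I. x k ^ (a(i := a i - 1)) k)))"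
    for x :: "'v \<Rightarrow> real"
  have "g \<in> poly_fun I D"
    unfolding g_def
  proof (intro poly_fun_sum poly_fun_scale poly_fun_monomial)
    fix a k assume "a \<in> I \<rightarrow>\<^sub>E {..D}" "k \<in> I"
    then have "a k \<le> D" by auto
    then show "(a(i := a i - 1)) k \<le> D" by auto
  qed
  moreover have "((\<lambda>s. f (x(i:=s))) has_real_derivative g x) (at (x i))" for x
  proof -
    have m: "((\<lambda>s. \<Prod>k\<in>I. (x(i:=s)) k ^ a k) has_real_derivative
        real (a i) * (\<Prod>k\<in>I. x k ^ (a(i := a i - 1)) k)) (at (x i))" for a
    proof -
      have e: "(\<Prod>k\<in>I. (x(i:=s)) k ^ a k) = s ^ a i * (\<Prod>k\<in>I-{i}. x k ^ a k)" for s
        using fin i by (simp add: prod.remove[of I i])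
      have "(\<Prod>k\<in>I. x k ^ (a(i := a i - 1)) k) = x i ^ (a i - 1) * (\<Prod>k\<in>I-{i}. x k ^ a k)"
        using fin i by (simp add: prod.remove[of I i])
      then show ?thesis unfolding e by (auto intro!: derivative_eq_intros)
    qed
    show ?thesis unfolding * g_def
      by (intro DERIV_sum DERIV_cmult m)
  qed
  ultimately show ?thesis by blast
qed

lemma poly_fun_continuous:
  assumes "f \<in> poly_fun I D"
  shows "continuous_on UNIV f"
proof -
  from assms obtain c where *:
    "f = (\<lambda>x. \<Sum>a\<in>PiE I (\<lambda>_. {..D}). c a * (\<Prod>i\<in>I. x i ^ a i))"
    unfolding poly_fun_def by auto
  show ?thesis unfolding *
    by (intro continuous_intros continuous_on_product_coordinates)
qed

end

section \<open>Linear dependence and generic points\<close>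

text \<open>Gaussian elimination, by induction on the set of equations: choose an unknown
  \<open>z\<close> with nonzero coefficient in equation \<open>y\<close>, eliminate it from the
  other equations (\<open>B\<close>), solve these without \<open>z\<close>, and let equation
  \<open>y\<close> dictate the value \<open>- s\<close> of \<open>z\<close>.\<close>

lemma underdetermined_system:
  fixes A :: "'x \<Rightarrow> 'y \<Rightarrow> real"
  assumes "finite Y" "finite X" "card Y < card X"
  shows "\<exists>u. (\<exists>x\<in>X. u x \<noteq> 0) \<and> (\<forall>y\<in>Y. (\<Sum>x\<in>X. u x * A x y) = 0)"
  using assms
proof (induction Y arbitrary: X A rule: finite_induct)
  case empty
  then obtain x where "x \<in> X" by fastforce
  then show ?case by (intro exI[of _ "\<lambda>_. 1"]) auto
next
  case (insert y Y)
  show ?case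
  proof (cases "\<forall>x\<in>X. A x y = 0")
    case True
    from insert.IH[of X A] insert.prems insert.hyps obtain u where
      "\<exists>x\<in>X. u x \<noteq> 0" "\<forall>y\<in>Y. (\<Sum>x\<in>X. u x * A x y) = 0" by auto
    with True show ?thesis by (intro exI[of _ u]) auto
  next
    case False
    then obtain z where z: "z \<in> X" "A z y \<noteq> 0" by auto
    define B where "B x v = A x v - A x y / A z y * A z v" for x v
    have "card Y < card (X - {z})" using insert z by auto
    from insert.IH[of "X - {z}" B, OF _ this] insert.prems obtain u where
      u: "\<exists>x\<in>X-{z}. u x \<noteq> 0" "\<forall>y\<in>Y. (\<Sum>x\<in>X-{z}. u x * B x y) = 0" by auto
    define s where "s = (\<Sum>x\<in>X-{z}. u x * (A x y / A z y))"
    define w where "w = u(z := - s)"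
    have w: "(\<Sum>x\<in>X. w x * A x v) = (\<Sum>x\<in>X-{z}. u x * B x v)" for v
    proof -
      have "(\<Sum>x\<in>X. w x * A x v) = - s * A z v + (\<Sum>x\<in>X-{z}. u x * A x v)"
        using z insert.prems by (simp add: sum.remove[of X z] w_def)
      also have "\<dots> = (\<Sum>x\<in>X-{z}. u x * B x v)"
        unfolding s_def B_def
        by (simp add: algebra_simps sum_subtractf sum_distrib_left sum_distrib_right)
      finally show ?thesis .
    qed
    have "(\<Sum>x\<in>X-{z}. u x * B x y) = 0" using z by (simp add: B_def)
    then have "\<forall>v\<in>insert y Y. (\<Sum>x\<in>X. w x * A x v) = 0" using u(2) by (auto simp: w)
    moreover have "\<exists>x\<in>X. w x \<noteq> 0" using u(1) by (auto simp: w_def)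
    ultimately show ?thesis by blast
  qed
qed

text \<open>A family with more members than there are monomials has linearly dependent coefficient
  vectors. The family is indexed by \<open>X\<close>, so coinciding members count
  separately.\<close>

lemma poly_fun_dependent:
  assumes "finite I" "finite X" "(D + 1) ^ card I < card X"
    and f: "\<And>a. a \<in> X \<Longrightarrow> f a \<in> poly_fun I D"
  shows "\<exists>u. (\<exists>a\<in>X. u a \<noteq> 0) \<and> (\<forall>x. (\<Sum>a\<in>X. u a * f a x) = 0)"
proof -
  let ?Y = "PiE I (\<lambda>_. {..D})"
  have "\<forall>a\<in>X. \<exists>c. \<forall>x. f a x = (\<Sum>e\<in>?Y. c e * (\<Prod>i\<in>I. x i ^ e i))"
    using f unfolding poly_fun_def by auto
  then obtain c where c: "\<And>a x. a \<in> X \<Longrightarrow> f a x = (\<Sum>e\<in>?Y. c a e * (\<Prod>i\<in>I. x i ^ e i))"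
    by metis
  have "card ?Y = (D + 1) ^ card I" using assms(1) by (simp add: card_PiE)
  moreover have "finite ?Y" using assms(1) by (intro finite_PiE) auto
  ultimately obtain u where u: "\<exists>a\<in>X. u a \<noteq> 0" "\<And>e. e \<in> ?Y \<Longrightarrow> (\<Sum>a\<in>X. u a * c a e) = 0"
    using underdetermined_system[of ?Y X c] assms by auto
  have "(\<Sum>a\<in>X. u a * f a x) = 0" for x
  proof -
    have "(\<Sum>a\<in>X. u a * f a x) = (\<Sum>a\<in>X. \<Sum>e\<in>?Y. u a * c a e * (\<Prod>i\<in>I. x i ^ e i))"
      by (intro sum.cong) (auto simp: c sum_distrib_left mult.assoc)
    also have "\<dots> = (\<Sum>e\<in>?Y. \<Sum>a\<in>X. u a * c a e * (\<Prod>i\<in>I. x i ^ e i))" by (rule sum.swap)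
    also have "\<dots> = (\<Sum>e\<in>?Y. (\<Sum>a\<in>X. u a * c a e) * (\<Prod>i\<in>I. x i ^ e i))"
      by (simp add: sum_distrib_right)
    also have "\<dots> = 0" using u(2) by simp
    finally show ?thesis .
  qed
  with u(1) show ?thesis by blast
qed

text \<open>Induction on the variables. For each \<open>j\<close> fix a power \<open>k j\<close> of
  the new variable whose coefficient is not the zero polynomial; the induction hypothesis yields one
  \<open>y\<close> at which all these coefficients are nonzero. Each specialized polynomial
  \<open>q j\<close> then has finitely many roots, and countably many finite sets do not exhaust an
  uncountable \<open>X\<close>.\<close>

lemma generic_point:
  fixes c :: "nat \<Rightarrow> ('v \<Rightarrow> nat) \<Rightarrow> real"
  assumes "finite I" "uncountable X"
    and "\<And>j. \<exists>a\<in>PiE I (\<lambda>_. {..A}). c j a \<noteq> 0"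
  shows "\<exists>y\<in>PiE I (\<lambda>_. X). \<forall>j. (\<Sum>a\<in>PiE I (\<lambda>_. {..A}). c j a * (\<Prod>i\<in>I. y i ^ a i)) \<noteq> (0::real)"
  using assms(1,3)
proof (induction I arbitrary: c rule: finite_induct)
  case empty
  then show ?case by (auto simp: PiE_empty_domain)
next
  case (insert v I)
  have "\<forall>j. \<exists>k a. k \<le> A \<and> a \<in> PiE I (\<lambda>_. {..A}) \<and> c j (a(v := k)) \<noteq> 0"
  proof
    fix j
    from insert.prems[of j] obtain b where "b \<in> PiE (insert v I) (\<lambda>_. {..A})" "c j b \<noteq> 0" by auto
    then show "\<exists>k a. k \<le> A \<and> a \<in> PiE I (\<lambda>_. {..A}) \<and> c j (a(v := k)) \<noteq> 0"
      unfolding PiE_insert_eq by auto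
  qed
  then obtain k a where ka: "\<And>j. k j \<le> A" "\<And>j. a j \<in> PiE I (\<lambda>_. {..A})"
      "\<And>j. c j ((a j)(v := k j)) \<noteq> 0" by metis
  from insert.IH[of "\<lambda>j e. c j (e(v := k j))"] ka obtain y where y: "y \<in> PiE I (\<lambda>_. X)"
    "\<And>j. (\<Sum>e\<in>PiE I (\<lambda>_. {..A}). c j (e(v := k j)) * (\<Prod>i\<in>I. y i ^ e i)) \<noteq> 0"
    by blast
  define q where "q j = (\<Sum>l\<le>A. monom (\<Sum>e\<in>PiE I (\<lambda>_. {..A}). c j (e(v := l)) * (\<Prod>i\<in>I. y i ^ e i)) l)" for j
  have "coeff (q j) (k j) \<noteq> 0" for j
    using y(2)[of j] ka(1)[of j] by (simp add: q_def coeff_sum)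
  then have "q j \<noteq> 0" for j by (metis coeff_0)
  then have "countable (\<Union>j. {t. poly (q j) t = 0})"
    by (intro countable_UN) (auto intro: countable_finite poly_roots_finite)
  then have "X - (\<Union>j. {t. poly (q j) t = 0}) \<noteq> {}"
    using \<open>uncountable X\<close> by (metis countable_subset Diff_eq_empty_iff)
  then obtain t where t: "t \<in> X" "\<And>j. poly (q j) t \<noteq> 0" by auto
  have "(\<Sum>b\<in>PiE (insert v I) (\<lambda>_. {..A}). c j b * (\<Prod>i\<in>insert v I. (y(v := t)) i ^ b i)) = poly (q j) t" for j
  proof -
    have inj: "inj_on (\<lambda>(l, e). e(v := l)) ({..A} \<times> PiE I (\<lambda>_. {..A}))"
      using insert.hyps inj_combinator[of v I "\<lambda>_. {..A}"] by auto
    have "(\<Sum>b\<in>PiE (insert v I) (\<lambda>_. {..A}). c j b * (\<Prod>i\<in>insert v I. (y(v := t)) i ^ b i))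
      = (\<Sum>(l, e)\<in>{..A} \<times> PiE I (\<lambda>_. {..A}). c j (e(v := l)) * (\<Prod>i\<in>insert v I. (y(v := t)) i ^ (e(v := l)) i))"
      unfolding PiE_insert_eq by (subst sum.reindex[OF inj]) (auto simp: case_prod_unfold)
    also have "\<dots> = (\<Sum>(l, e)\<in>{..A} \<times> PiE I (\<lambda>_. {..A}). c j (e(v := l)) * (\<Prod>i\<in>I. y i ^ e i) * t ^ l)"
    proof (intro sum.cong refl, clarify)
      fix l e
      have "(\<Prod>i\<in>I. (y(v := t)) i ^ (e(v := l)) i) = (\<Prod>i\<in>I. y i ^ e i)"
        using insert.hyps by (intro prod.cong) auto
      then show "c j (e(v := l)) * (\<Prod>i\<in>insert v I. (y(v := t)) i ^ (e(v := l)) i)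
        = c j (e(v := l)) * (\<Prod>i\<in>I. y i ^ e i) * t ^ l"
        using insert.hyps by (simp del: fun_upd_apply) simp
    qed
    also have "\<dots> = poly (q j) t"
      by (simp add: q_def poly_sum poly_monom sum.cartesian_product[symmetric] sum_distrib_right)
    finally show ?thesis .
  qed
  moreover have "y(v := t) \<in> PiE (insert v I) (\<lambda>_. X)"
    using y(1) t(1) by (auto simp: PiE_iff extensional_def)
  ultimately show ?case using t(2) by metis
qed

text \<open>This takes the place of Bezout's theorem. One solution is picked in each cell, so the
  whole solution set may well be infinite, and the freedom in \<open>c\<close> allows a generic
  right-hand side. A polynomial relation between the \<open>F i\<close> and a linear form becomes,
  on the picked points, a one-variable equation for the value of that form.\<close>

lemma card_common_solutions_le:
  fixes F :: "'v \<Rightarrow> ('v \<Rightarrow> real) \<Rightarrow> real" and cell :: "'s \<Rightarrow> ('v \<Rightarrow> real) set"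
  assumes fin: "finite I" "finite S" and "0 < \<epsilon>"
    and F: "\<And>i. i \<in> I \<Longrightarrow> F i \<in> poly_fun I E"
    and sol: "\<And>c s. c \<in> PiE I (\<lambda>_. {0<..<\<epsilon>}) \<Longrightarrow> s \<in> S \<Longrightarrow> \<exists>x\<in>cell s. \<forall>i\<in>I. F i x = c i"
    and disj: "\<And>s s' x x'. s \<in> S \<Longrightarrow> s' \<in> S \<Longrightarrow> s \<noteq> s' \<Longrightarrow> x \<in> cell s \<Longrightarrow> x' \<in> cell s' \<Longrightarrow> \<exists>i\<in>I. x i \<noteq> x' i"
  shows "card S \<le> (card I * E + 1) ^ card I"
proof -
  define M where "M = card I"
  \<comment> \<open>Exponents up to \<open>B\<close> give \<open>(B + 1) ^ M * (B + 1)\<close>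
    products of powers of the \<open>F i\<close> and of the linear form. There are at most
    \<open>((B + 1) * (M * E + 1)) ^ M = (B + 1) ^ M * B\<close> monomials to express them, just too
    few for independence.\<close>
  define B where "B = (M * E + 1) ^ M"
  define P where "P = PiE I (\<lambda>_. {..B})"
  define X where "X = P \<times> {..B}"
  have finP: "finite P" using fin unfolding P_def by (intro finite_PiE) auto
  obtain \<iota> where \<iota>: "bij_betw \<iota> I {0..<M}"
    using ex_bij_betw_finite_nat[OF fin(1)] unfolding M_def by auto
  \<comment> \<open>The countably many linear forms \<open>lam j\<close> separate any finite set of points for some \<open>j\<close>; a single \<open>c\<close> is
    generic for all of them at once.\<close>
  define lam where "lam j x = (\<Sum>i\<in>I. real j ^ \<iota> i * x i)" for j :: nat and x :: "'v \<Rightarrow> real"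
  have lam: "lam j \<in> poly_fun I 1" for j
    unfolding lam_def using fin(1) by (intro poly_fun_sum poly_fun_scale poly_fun_var) auto
  have "\<exists>u. (\<exists>a\<in>X. u a \<noteq> 0) \<and>
      (\<forall>x. (\<Sum>a\<in>X. u a * ((\<Prod>i\<in>I. F i x ^ fst a i) * lam j x ^ snd a)) = 0)" for j
  proof (rule poly_fun_dependent)
    show "finite I" "finite X" using fin finP by (auto simp: X_def)
    show "(\<lambda>x. (\<Prod>i\<in>I. F i x ^ fst a i) * lam j x ^ snd a) \<in> poly_fun I (M * B * E + B)"
      if "a \<in> X" for a
    proof (rule poly_fun_mono[OF fin(1) poly_fun_mult[OF fin(1) poly_fun_prod[OF fin(1)] poly_fun_power[OF fin(1) lam]]])
      show "(\<lambda>x. F i x ^ fst a i) \<in> poly_fun I (fst a i * E)" if "i \<in> I" for i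
        by (rule poly_fun_power[OF fin(1) F[OF that]])
      have "(\<Sum>i\<in>I. fst a i * E) \<le> (\<Sum>i\<in>I. B * E)"
        using \<open>a \<in> X\<close> by (intro sum_mono mult_right_mono) (auto simp: X_def P_def PiE_iff)
      then show "(\<Sum>i\<in>I. fst a i * E) + snd a * 1 \<le> M * B * E + B"
        using \<open>a \<in> X\<close> by (auto simp: X_def M_def)
    qed
    have "(M * B * E + B + 1) ^ M \<le> ((B + 1) * (M * E + 1)) ^ M"
      by (intro power_mono) (auto simp: algebra_simps)
    also have "\<dots> = (B + 1) ^ M * B" by (subst power_mult_distrib) (simp add: B_def)
    also have "\<dots> < (B + 1) ^ M * (B + 1)" by simp
    also have "\<dots> = card X" using fin by (simp add: X_def P_def card_PiE M_def card_cartesian_product)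
    finally show "(M * B * E + B + 1) ^ card I < card X" by (simp add: M_def)
  qed
  then obtain u where "\<forall>j. (\<exists>a\<in>X. u j a \<noteq> 0) \<and>
      (\<forall>x. (\<Sum>a\<in>X. u j a * ((\<Prod>i\<in>I. F i x ^ fst a i) * lam j x ^ snd a)) = 0)"
    using choice[of "\<lambda>j u. (\<exists>a\<in>X. u a \<noteq> 0) \<and>
      (\<forall>x. (\<Sum>a\<in>X. u a * ((\<Prod>i\<in>I. F i x ^ fst a i) * lam j x ^ snd a)) = 0)"] by blast
  then have u: "\<And>j. \<exists>a\<in>X. u j a \<noteq> 0"
    "\<And>j x. (\<Sum>a\<in>X. u j a * ((\<Prod>i\<in>I. F i x ^ fst a i) * lam j x ^ snd a)) = 0"
    by blast+
  \<comment> \<open>In each relation one power \<open>b j\<close> of the linear form is singled out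
    whose coefficient, a polynomial in the \<open>F i\<close>, is nonzero. A generic
    \<open>y\<close> has to keep only these countably many coefficients from vanishing.\<close>
  have "\<forall>j. \<exists>b\<le>B. \<exists>a\<in>P. u j (a, b) \<noteq> 0" using u(1) unfolding X_def by fastforce
  then obtain b where b: "\<And>j. b j \<le> B" "\<And>j. \<exists>a\<in>P. u j (a, b j) \<noteq> 0" by metis
  obtain y where y: "y \<in> PiE I (\<lambda>_. {0<..<\<epsilon>})"
    "\<And>j. (\<Sum>a\<in>P. u j (a, b j) * (\<Prod>i\<in>I. y i ^ a i)) \<noteq> 0"
    using generic_point[of I "{0<..<\<epsilon>}" B "\<lambda>j a. u j (a, b j)"] fin \<open>0 < \<epsilon>\<close> b
    unfolding P_def by (auto simp: uncountable_open_interval)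
  from sol[OF y(1)] obtain x where x: "\<And>s. s \<in> S \<Longrightarrow> x s \<in> cell s"
    "\<And>s i. s \<in> S \<Longrightarrow> i \<in> I \<Longrightarrow> F i (x s) = y i" by metis
  \<comment> \<open>The relation number \<open>j\<close> after substituting \<open>y i\<close> for
    \<open>F i\<close>: a polynomial in the value of \<open>lam j\<close> alone.\<close>
  define q where "q j = (\<Sum>l\<le>B. monom (\<Sum>a\<in>P. u j (a, l) * (\<Prod>i\<in>I. y i ^ a i)) l)" for j
  have "coeff (q j) (b j) \<noteq> 0" for j
    using y(2)[of j] b(1)[of j] by (simp add: q_def coeff_sum)
  then have q0: "q j \<noteq> 0" for j by (metis coeff_0)
  have qdeg: "degree (q j) \<le> B" for j
    unfolding q_def by (intro degree_sum_le) (auto intro: order_trans[OF degree_monom_le])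
  have qroot: "poly (q j) (lam j (x s)) = 0" if "s \<in> S" for s j
  proof -
    have "poly (q j) (lam j (x s)) = (\<Sum>l\<le>B. \<Sum>a\<in>P. u j (a, l) * ((\<Prod>i\<in>I. F i (x s) ^ a i) * lam j (x s) ^ l))"
      using x(2)[OF that] by (simp add: q_def poly_sum poly_monom sum_distrib_right mult.assoc)
    also have "\<dots> = (\<Sum>a\<in>P. \<Sum>l\<le>B. u j (a, l) * ((\<Prod>i\<in>I. F i (x s) ^ a i) * lam j (x s) ^ l))"
      by (rule sum.swap)
    also have "\<dots> = 0"
      using u(2)[of j "x s"] by (simp add: X_def sum.cartesian_product case_prod_unfold)
    finally show ?thesis .
  qed
  have "finite {j. lam j (x s) = lam j (x s')}" if ss: "s \<in> S" "s' \<in> S" "s \<noteq> s'" for s s'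
  proof -
    \<comment> \<open>\<open>lam j\<close> identifies the two points exactly when
      \<open>real j\<close> is a root of \<open>p\<close>. Since \<iota> is injective, distinct
      coordinates feed distinct coefficients, so \<open>p\<close> is nonzero and only finitely many
      \<open>j\<close> are bad.\<close>
    define p where "p = (\<Sum>i\<in>I. monom (x s i - x s' i) (\<iota> i))"
    obtain i where i: "i \<in> I" "x s i \<noteq> x s' i" using disj ss x(1) by blast
    have "coeff p (\<iota> i) = (\<Sum>k\<in>I. if k = i then x s k - x s' k else 0)"
      unfolding p_def coeff_sum using \<iota> i(1)
      by (intro sum.cong) (auto simp: bij_betw_def inj_on_def)
    also have "\<dots> \<noteq> 0" using i fin by simp
    finally have "p \<noteq> 0" by auto
    moreover have "poly p (real j) = lam j (x s) - lam j (x s')" for j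
      by (simp add: p_def lam_def poly_sum poly_monom algebra_simps sum_subtractf)
    ultimately have "finite (real -` {t. poly p t = 0})"
      by (intro finite_vimageI poly_roots_finite) (auto simp: inj_on_def)
    moreover have "{j. lam j (x s) = lam j (x s')} \<subseteq> real -` {t. poly p t = 0}"
      using \<open>\<And>j. poly p (real j) = _\<close> by auto
    ultimately show ?thesis by (rule rev_finite_subset)
  qed
  then have "finite (\<Union>(s, s')\<in>{(s, s'). s \<in> S \<and> s' \<in> S \<and> s \<noteq> s'}. {j. lam j (x s) = lam j (x s')})"
    by (intro finite_UN_I) (auto intro!: finite_subset[OF _ finite_cartesian_product[OF fin(2) fin(2)]])
  then obtain j where j: "j \<notin> (\<Union>(s, s')\<in>{(s, s'). s \<in> S \<and> s' \<in> S \<and> s \<noteq> s'}. {j. lam j (x s) = lam j (x s')})"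
    using ex_new_if_finite[OF infinite_UNIV_nat] by blast
  then have "inj_on (\<lambda>s. lam j (x s)) S" by (auto simp: inj_on_def)
  then have "card S = card ((\<lambda>s. lam j (x s)) ` S)" by (simp add: card_image)
  also have "\<dots> \<le> card {t. poly (q j) t = 0}"
    using qroot q0 by (intro card_mono poly_roots_finite) auto
  also have "\<dots> \<le> degree (q j)" by (rule card_poly_roots_bound[OF q0])
  also have "\<dots> \<le> B" by (rule qdeg)
  finally show ?thesis by (simp add: B_def M_def)
qed

section \<open>Counting positivity patterns through critical points of a tilted product\<close>

lemma poly_fun_restrict:
  assumes "f \<in> poly_fun I D" "\<And>i. i \<in> I \<Longrightarrow> x i = y i"
  shows "f x = f y"
proof -
  from assms(1) obtain c where *:
    "\<And>x. f x = (\<Sum>a\<in>PiE I (\<lambda>_. {..D}). c a * (\<Prod>i\<in>I. x i ^ a i))"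
    unfolding poly_fun_def by auto
  show ?thesis unfolding * using assms(2) by (intro sum.cong arg_cong2[where f = "(*)"] prod.cong) auto
qed

lemma finite_positive_lower_bound:
  fixes A :: "real set"
  assumes "finite A"
  shows "\<exists>e>0. \<forall>a\<in>A. a > 0 \<longrightarrow> e < a"
proof -
  define m where "m = Min (insert 1 {a\<in>A. a > 0})"
  have "m > 0" using assms by (simp add: m_def)
  moreover have "m \<le> a" if "a \<in> A" "a > 0" for a
    unfolding m_def using assms that by (intro Min_le) auto
  ultimately have "m / 2 < a" if "a \<in> A" "a > 0" for a using that by fastforce
  with \<open>m > 0\<close> show ?thesis by (intro exI[of _ "m / 2"]) auto
qed

text \<open>Pinning the coordinates outside \<open>I\<close> to 0 makes the box a product of compact
  sets, so Tychonoff's theorem applies even when the type of variables is infinite.\<close>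

lemma compact_box_fun: "compact {x :: 'v \<Rightarrow> real. \<forall>i. if i \<in> I then \<bar>x i\<bar> \<le> R else x i = 0}"
proof -
  have "{x :: 'v \<Rightarrow> real. \<forall>i. if i \<in> I then \<bar>x i\<bar> \<le> R else x i = 0} =
      PiE UNIV (\<lambda>i. if i \<in> I then {-R..R} else {0})"
    by (auto simp: PiE_iff abs_le_iff split: if_splits) (smt (verit))+
  moreover have "compactin (product_topology (\<lambda>i. euclidean) UNIV) (PiE (UNIV :: 'v set) (\<lambda>i. if i \<in> I then {-R..R} else {0}))"
    unfolding compactin_PiE by auto
  ultimately show ?thesis by (simp add: euclidean_product_topology)
qed

text \<open>Every pattern is given a cell that contains a solution of "gradient of \<open>G\<close>
  equals \<open>c\<close>" for all small positive \<open>c\<close>;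
  \<open>card_common_solutions_le\<close> then counts the cells. Zero is grouped with the negative
  values, which fits the strict comparisons in \<open>predictor\<close>.\<close>

theorem card_positivity_patterns_le:
  fixes f :: "'k \<Rightarrow> ('v \<Rightarrow> real) \<Rightarrow> real"
  assumes fin: "finite I" "finite K"
    and f: "\<And>k. k \<in> K \<Longrightarrow> f k \<in> poly_fun I D"
  shows "card (range (\<lambda>x. {k\<in>K. f k x > 0})) \<le> (2 * card I * (card I + card K * D) + 1) ^ card I"
proof -
  define S where "S = range (\<lambda>x. {k\<in>K. f k x > 0})"
  have finS: "finite S" unfolding S_def using fin(2) by (intro finite_subset[OF _ finite_Pow_iff[THEN iffD2]]) auto
  have "\<forall>s\<in>S. \<exists>x. s = {k\<in>K. f k x > 0} \<and> (\<forall>i. i \<notin> I \<longrightarrow> x i = 0)"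
  proof
    fix s assume "s \<in> S"
    then obtain x where x: "s = {k\<in>K. f k x > 0}" by (auto simp: S_def)
    \<comment> \<open>Coordinates outside \<open>I\<close> are reset to 0 so that the witness can
      lie in the compact box defined below.\<close>
    let ?x = "\<lambda>i. if i \<in> I then x i else 0"
    have "f k ?x = f k x" if "k \<in> K" for k
      by (rule poly_fun_restrict[OF f[OF that]]) auto
    then show "\<exists>x. s = {k\<in>K. f k x > 0} \<and> (\<forall>i. i \<notin> I \<longrightarrow> x i = 0)"
      using x by (intro exI[of _ ?x]) auto
  qed
  then obtain w where w: "\<And>s. s \<in> S \<Longrightarrow> s = {k\<in>K. f k (w s) > 0}" "\<And>s i. s \<in> S \<Longrightarrow> i \<notin> I \<Longrightarrow> w s i = 0"
    by metis
  obtain \<eta> where \<eta>: "\<eta> > 0" "\<And>s k. s \<in> S \<Longrightarrow> k \<in> K \<Longrightarrow> f k (w s) > 0 \<Longrightarrow> \<eta> < f k (w s)"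
    using finite_positive_lower_bound[of "(\<lambda>(s, k). f k (w s)) ` (S \<times> K)"] finS fin by fastforce
  \<comment> \<open>The summand 1 puts every witness strictly inside the box, and inserting 0 covers
    an empty set of coordinates.\<close>
  define R where "R = Max (insert 0 ((\<lambda>(s, i). \<bar>w s i\<bar>) ` (S \<times> I))) + 1"
  have wR: "\<bar>w s i\<bar> < R" if "s \<in> S" "i \<in> I" for s i
  proof -
    have "\<bar>w s i\<bar> \<le> Max (insert 0 ((\<lambda>(s, i). \<bar>w s i\<bar>) ` (S \<times> I)))"
      using that finS fin by (intro Max_ge) auto
    then show ?thesis by (simp add: R_def)
  qed
  have "R > 0"
  proof -
    have "0 \<le> Max (insert 0 ((\<lambda>(s, i). \<bar>w s i\<bar>) ` (S \<times> I)))" using finS fin by (intro Max_ge) auto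
    then show ?thesis by (simp add: R_def)
  qed
  \<comment> \<open>The shift makes all polynomials nonzero at the witnesses without changing the positivity pattern.\<close>
  define h where "h k x = f k x - \<eta>" for k x
  have h: "h k \<in> poly_fun I D" if "k \<in> K" for k
    unfolding h_def using fin by (intro poly_fun_diff f that poly_fun_const)
  \<comment> \<open>\<open>G\<close> is nonnegative on the box and vanishes on its faces and
    wherever some \<open>h k\<close> vanishes. A point of the box with \<open>G\<close> positive is
    therefore off all these boundaries; squaring the \<open>h k\<close> makes this independent of
    the pattern.\<close>
  define G where "G x = (\<Prod>i\<in>I. R\<^sup>2 - x i ^ 2) * (\<Prod>k\<in>K. h k x ^ 2)" for x
  define E where "E = 2 * (card I + card K * D)"
  have G: "G \<in> poly_fun I E"
  proof -
    have "(\<lambda>x. (\<Prod>i\<in>I. R\<^sup>2 - x i ^ 2)) \<in> poly_fun I (\<Sum>i\<in>I. 2 * 1)"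
      using fin by (intro poly_fun_prod poly_fun_diff poly_fun_const poly_fun_power poly_fun_var) auto
    moreover have "(\<lambda>x. (\<Prod>k\<in>K. h k x ^ 2)) \<in> poly_fun I (\<Sum>k\<in>K. 2 * D)"
      using fin by (intro poly_fun_prod poly_fun_power h)
    ultimately have "G \<in> poly_fun I ((\<Sum>i\<in>I. 2 * 1) + (\<Sum>k\<in>K. 2 * D))"
      unfolding G_def using fin by (intro poly_fun_mult)
    then show ?thesis by (simp add: E_def algebra_simps)
  qed
  have "\<forall>i\<in>I. \<exists>g\<in>poly_fun I E. \<forall>x. ((\<lambda>s. G (x(i:=s))) has_real_derivative g x) (at (x i))"
    using poly_fun_deriv[OF fin(1) G] by auto
  then obtain F where F: "\<And>i. i \<in> I \<Longrightarrow> F i \<in> poly_fun I E"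
    "\<And>i x. i \<in> I \<Longrightarrow> ((\<lambda>s. G (x(i:=s))) has_real_derivative F i x) (at (x i))" by metis
  define sg where "sg s k = (if k \<in> s then 1 else -1 :: real)" for s :: "'k set" and k
  define box where "box = {x :: 'v \<Rightarrow> real. \<forall>i. if i \<in> I then \<bar>x i\<bar> \<le> R else x i = 0}"
  \<comment> \<open>\<open>Cl s\<close> uses weak inequalities and so is compact; on its part
    \<open>cell s\<close>, where \<open>G\<close> is positive, all of them are strict.\<close>
  define Cl where "Cl s = {x\<in>box. \<forall>k\<in>K. sg s k * h k x \<ge> 0}" for s
  define cell where "cell s = {x\<in>Cl s. G x > 0}" for s
  have sq: "0 \<le> R\<^sup>2 - x i ^ 2" if "x \<in> box" "i \<in> I" for x i
  proof -
    have "\<bar>x i\<bar> \<le> R" using that by (auto simp: box_def split: if_splits)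
    then have "\<bar>x i\<bar> ^ 2 \<le> R ^ 2" by (intro power_mono) auto
    then show ?thesis by simp
  qed
  have Gnn: "G x \<ge> 0" if "x \<in> box" for x
    unfolding G_def using sq[OF that] by (intro mult_nonneg_nonneg prod_nonneg) auto
  have Gnz: "k \<in> K \<Longrightarrow> h k x \<noteq> 0" "i \<in> I \<Longrightarrow> R\<^sup>2 - x i ^ 2 \<noteq> 0" if "G x > 0" for x k i
  proof -
    have "(\<Prod>i\<in>I. R\<^sup>2 - x i ^ 2) \<noteq> 0" "(\<Prod>k\<in>K. h k x ^ 2) \<noteq> 0"
      using that unfolding G_def by (intro notI; simp)+
    then show "k \<in> K \<Longrightarrow> h k x \<noteq> 0" "i \<in> I \<Longrightarrow> R\<^sup>2 - x i ^ 2 \<noteq> 0"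
      using fin by (force simp: prod_zero_iff)+
  qed
  have Gw: "G (w s) > 0" and wCl: "w s \<in> Cl s" if s: "s \<in> S" for s
  proof -
    have hs: "sg s k * h k (w s) > 0" if "k \<in> K" for k
    proof (cases "f k (w s) > 0")
      case True
      then have "k \<in> s" using w(1)[OF s] that by auto
      then show ?thesis using \<eta>(2)[OF s that True] by (simp add: sg_def h_def)
    next
      case False
      then have "k \<notin> s" using w(1)[OF s] that by auto
      then show ?thesis using False \<eta>(1) by (simp add: sg_def h_def)
    qed
    show "w s \<in> Cl s"
      using hs wR[OF s] w(2)[OF s] by (auto simp: Cl_def box_def less_imp_le)
    have "w s i ^ 2 < R\<^sup>2" if "i \<in> I" for i
    proof -
      have "\<bar>w s i\<bar> ^ 2 < R ^ 2" using wR[OF s that] by (intro power_strict_mono) auto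
      then show ?thesis by simp
    qed
    moreover have "h k (w s) \<noteq> 0" if "k \<in> K" for k using hs[OF that] by auto
    ultimately show "G (w s) > 0"
      unfolding G_def by (intro mult_pos_pos prod_pos) auto
  qed
  obtain g where g: "g > 0" "\<And>s. s \<in> S \<Longrightarrow> g < G (w s)"
    using finite_positive_lower_bound[of "(\<lambda>s. G (w s)) ` S"] finS Gw by auto
  define M where "M = real (card I)"
  \<comment> \<open>On the box the tilt \<open>L\<close> below is at most
    \<open>M * (\<epsilon> * R)\<close> in absolute value, so its oscillation stays under the gap
    \<open>g\<close> between the witness values of \<open>G\<close> and 0. The summand 1 keeps the
    denominator positive when \<open>I\<close> is empty.\<close>
  define \<epsilon> where "\<epsilon> = g / (2 * M * R + 1)"
  have MR: "2 * M * R + 1 > 0" using \<open>R > 0\<close> by (simp add: M_def add_nonneg_pos)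
  have \<epsilon>: "\<epsilon> > 0" using g MR by (simp add: \<epsilon>_def)
  have \<epsilon>g: "2 * (M * (\<epsilon> * R)) < g"
  proof -
    have "\<epsilon> * (2 * M * R + 1) = g" using MR by (simp add: \<epsilon>_def)
    then show ?thesis using \<epsilon> by (simp add: algebra_simps)
  qed
  have Clcompact: "compact (Cl s)" for s
  proof -
    have "closed {x. sg s k * h k x \<ge> 0}" if "k \<in> K" for k
      using poly_fun_continuous[OF fin(1) h[OF that]] by (intro closed_Collect_le continuous_intros) auto
    then have "closed (\<Inter>k\<in>K. {x. sg s k * h k x \<ge> 0})" by auto
    then have "compact (box \<inter> (\<Inter>k\<in>K. {x. sg s k * h k x \<ge> 0}))"
      unfolding box_def by (intro compact_Int_closed compact_box_fun)
    moreover have "Cl s = box \<inter> (\<Inter>k\<in>K. {x. sg s k * h k x \<ge> 0})" by (auto simp: Cl_def)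
    ultimately show ?thesis by simp
  qed
  have sol: "\<exists>x\<in>cell s. \<forall>i\<in>I. F i x = c i" if c: "c \<in> PiE I (\<lambda>_. {0<..<\<epsilon>})" and s: "s \<in> S" for c s
  proof -
    define L where "L x = (\<Sum>i\<in>I. c i * x i)" for x :: "'v \<Rightarrow> real"
    have Lbd: "\<bar>L x\<bar> \<le> M * (\<epsilon> * R)" if "x \<in> box" for x
    proof -
      have "\<bar>L x\<bar> \<le> (\<Sum>i\<in>I. \<bar>c i * x i\<bar>)" unfolding L_def by (rule sum_abs)
      also have "\<dots> \<le> (\<Sum>i\<in>I. \<epsilon> * R)"
      proof (intro sum_mono)
        fix i assume "i \<in> I"
        then have "0 < c i" "c i < \<epsilon>" "\<bar>x i\<bar> \<le> R" using c that by (auto simp: box_def PiE_iff split: if_splits)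
        then show "\<bar>c i * x i\<bar> \<le> \<epsilon> * R" unfolding abs_mult by (intro mult_mono) auto
      qed
      finally show ?thesis by (simp add: M_def)
    qed
    have "continuous_on (Cl s) (\<lambda>x. G x - L x)"
      unfolding L_def
      by (intro continuous_intros continuous_on_subset[OF poly_fun_continuous[OF fin(1) G]]
          continuous_on_subset[OF continuous_on_product_coordinates]) auto
    then obtain x where x: "x \<in> Cl s" "\<And>y. y \<in> Cl s \<Longrightarrow> G y - L y \<le> G x - L x"
      using continuous_attains_sup[OF Clcompact, of s "\<lambda>x. G x - L x"] wCl[OF s] by blast
    have xbox: "x \<in> box" using x(1) by (simp add: Cl_def)
    have wbox: "w s \<in> box" using wCl[OF s] by (simp add: Cl_def)
    have Gx: "G x > 0"
    \<comment> \<open>If the maximizer had \<open>G x = 0\<close>, the witness \<open>w s\<close>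
      would give a larger tilted value, since \<open>G (w s) > g\<close> exceeds any change of the
      tilt.\<close>
    proof (rule ccontr)
      assume "\<not> G x > 0"
      then have "G x = 0" using Gnn[OF xbox] by simp
      then show False using x(2)[OF wCl[OF s]] Lbd[OF xbox] Lbd[OF wbox] g(2)[OF s] \<epsilon>g by linarith
    qed
    have hx: "sg s k * h k x > 0" if "k \<in> K" for k
    proof -
      have "h k x \<noteq> 0" by (rule Gnz(1)[OF Gx that])
      moreover have "sg s k \<noteq> 0" by (simp add: sg_def)
      moreover have "sg s k * h k x \<ge> 0" using x(1) that by (simp add: Cl_def)
      ultimately show ?thesis by (simp add: less_le)
    qed
    have xR: "\<bar>x i\<bar> < R" if "i \<in> I" for i
    proof -
      have "R\<^sup>2 - x i ^ 2 \<noteq> 0" by (rule Gnz(2)[OF Gx that])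
      then have "\<bar>x i\<bar> \<noteq> R" by auto
      moreover have "\<bar>x i\<bar> \<le> R" using xbox that by (auto simp: box_def split: if_splits)
      ultimately show ?thesis by simp
    qed
    have "F i x = c i" if i: "i \<in> I" for i
    proof -
      \<comment> \<open>The strict inequalities at \<open>x\<close> survive small changes of one
        coordinate, so \<open>x\<close> is a local maximum along every coordinate line through it.
        One-variable calculus then gives each component of the gradient equation.\<close>
      have ev: "\<forall>\<^sub>F t in at (x i). x(i := t) \<in> Cl s"
      proof -
        have "\<forall>\<^sub>F t in at (x i). sg s k * h k (x(i := t)) > 0" if k: "k \<in> K" for k
        proof -
          obtain g' where "((\<lambda>t. h k (x(i:=t))) has_real_derivative g' x) (at (x i))"
            using poly_fun_deriv[OF fin(1) h[OF k] i] by blast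
          then have "isCont (\<lambda>t. h k (x(i:=t))) (x i)" by (rule DERIV_isCont)
          then have "((\<lambda>t. sg s k * h k (x(i:=t))) \<longlongrightarrow> sg s k * h k x) (at (x i))"
            unfolding isCont_def by (intro tendsto_mult tendsto_const) simp
          then show ?thesis using hx[OF k] by (rule order_tendstoD(1))
        qed
        then have "\<forall>\<^sub>F t in at (x i). \<forall>k\<in>K. sg s k * h k (x(i := t)) > 0"
          using fin by (simp add: eventually_ball_finite)
        moreover have "\<forall>\<^sub>F t in at (x i). \<bar>t\<bar> < R"
          by (rule order_tendstoD(2)[OF tendsto_rabs[OF tendsto_ident_at] xR[OF i]])
        ultimately show ?thesis
        proof eventually_elim
          case (elim t)
          then show ?case using xbox i by (auto simp: Cl_def box_def less_imp_le)
        qed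
      qed
      then obtain d where d: "d > 0" "\<And>t. t \<noteq> x i \<Longrightarrow> dist t (x i) < d \<Longrightarrow> x(i := t) \<in> Cl s"
        unfolding eventually_at by auto
      have Lx: "L (x(i := t)) = c i * t + (\<Sum>k\<in>I-{i}. c k * x k)" for t
        using fin i by (simp add: L_def sum.remove[of I i])
      have "((\<lambda>t. G (x(i := t)) - L (x(i := t))) has_real_derivative F i x - c i) (at (x i))"
        unfolding Lx using F(2)[OF i, of x] by (auto intro!: derivative_eq_intros)
      then have "F i x - c i = 0"
      proof (rule DERIV_local_max[OF _ d(1)], intro allI impI)
        fix t assume "\<bar>x i - t\<bar> < d"
        then have "x(i := t) \<in> Cl s" using d(2)[of t] x(1) by (cases "t = x i") (auto simp: dist_real_def)
        then show "G (x(i := t)) - L (x(i := t)) \<le> G (x(i := x i)) - L (x(i := x i))"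
          using x(2) by simp
      qed
      then show ?thesis by simp
    qed
    then show ?thesis using x(1) Gx by (auto simp: cell_def)
  qed
  have "card S \<le> (card I * E + 1) ^ card I"
  proof (rule card_common_solutions_le[OF fin(1) finS \<epsilon> F(1) sol])
    \<comment> \<open>Different patterns disagree at some \<open>k\<close>, so \<open>h k\<close>
      has opposite signs on the two cells; as \<open>h k\<close> sees only coordinates in
      \<open>I\<close>, the points must differ there.\<close>
    fix s s' x x' assume ss: "s \<in> S" "s' \<in> S" "s \<noteq> s'" and xx: "x \<in> cell s" "x' \<in> cell s'"
    have "s \<subseteq> K" "s' \<subseteq> K" using w(1) ss by blast+
    then obtain k where "k \<in> K" "k \<in> s \<longleftrightarrow> k \<notin> s'" using ss(3) by blast
    then have k: "k \<in> K" "sg s k = - sg s' k" by (auto simp: sg_def)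
    show "\<exists>i\<in>I. x i \<noteq> x' i"
    proof (rule ccontr)
      assume "\<not> ?thesis"
      then have "h k x = h k x'" by (intro poly_fun_restrict[OF h[OF k(1)]]) auto
      moreover have "h k x \<noteq> 0" "sg s k * h k x \<ge> 0" "sg s' k * h k x' \<ge> 0"
        using xx k(1) Gnz(1) by (auto simp: cell_def Cl_def)
      ultimately show False using k(2) by (auto simp: sg_def split: if_splits)
    qed
  qed auto
  then show ?thesis by (simp add: S_def E_def algebra_simps)
qed

section \<open>Uniform deviation bounds by symmetrization\<close>

lemma expectation_pair_pmf_finite:
  fixes f :: "'a \<times> 'b \<Rightarrow> real"
  assumes "finite (set_pmf p)" "finite (set_pmf q)"
  shows "measure_pmf.expectation (pair_pmf p q) f =
    measure_pmf.expectation p (\<lambda>x. measure_pmf.expectation q (\<lambda>y. f (x, y)))"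
proof -
  have "measure_pmf.expectation (pair_pmf p q) f =
      (\<Sum>z\<in>set_pmf p \<times> set_pmf q. f z * pmf (pair_pmf p q) z)"
    using assms by (intro integral_measure_pmf_real) auto
  also have "\<dots> = (\<Sum>x\<in>set_pmf p. \<Sum>y\<in>set_pmf q. f (x, y) * (pmf p x * pmf q y))"
    unfolding sum.cartesian_product by (intro sum.cong) (auto simp: pmf_pair)
  also have "\<dots> = (\<Sum>x\<in>set_pmf p. (\<Sum>y\<in>set_pmf q. f (x, y) * pmf q y) * pmf p x)"
    by (simp add: sum_distrib_left sum_distrib_right mult_ac)
  also have "\<dots> = measure_pmf.expectation p (\<lambda>x. \<Sum>y\<in>set_pmf q. f (x, y) * pmf q y)"
    using assms by (intro integral_measure_pmf_real[symmetric]) auto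
  also have "(\<lambda>x. \<Sum>y\<in>set_pmf q. f (x, y) * pmf q y) = (\<lambda>x. measure_pmf.expectation q (\<lambda>y. f (x, y)))"
    using assms by (intro ext integral_measure_pmf_real[symmetric]) auto
  finally show ?thesis .
qed

lemma expectation_pmf_mono:
  fixes f g :: "'a \<Rightarrow> real"
  assumes "finite (set_pmf p)" "\<And>x. x \<in> set_pmf p \<Longrightarrow> f x \<le> g x"
  shows "measure_pmf.expectation p f \<le> measure_pmf.expectation p g"
  using assms by (intro integral_mono_AE integrable_measure_pmf_finite) (auto simp: AE_measure_pmf_iff)

text \<open>Jensen's inequality for \<open>exp\<close>, obtained by averaging the tangent line bound
  at the mean.\<close>

lemma exp_expectation_le:
  fixes f :: "'a \<Rightarrow> real"
  assumes "finite (set_pmf p)"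
  shows "exp (measure_pmf.expectation p f) \<le> measure_pmf.expectation p (\<lambda>x. exp (f x))"
proof -
  let ?y = "measure_pmf.expectation p f"
  have int: "integrable (measure_pmf p) g" for g :: "'a \<Rightarrow> real"
    using assms by (rule integrable_measure_pmf_finite)
  have "exp ?y = measure_pmf.expectation p (\<lambda>x. exp ?y * (1 + (f x - ?y)))"
    by (simp add: int)
  also have "\<dots> \<le> measure_pmf.expectation p (\<lambda>x. exp (f x))"
  proof (rule expectation_pmf_mono[OF assms])
    fix x
    have "exp ?y * (1 + (f x - ?y)) \<le> exp ?y * exp (f x - ?y)"
      by (intro mult_left_mono exp_ge_add_one_self) auto
    then show "exp ?y * (1 + (f x - ?y)) \<le> exp (f x)" by (simp add: exp_diff)
  qed
  finally show ?thesis .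
qed

text \<open>The moment generating function of a fair random sign. For nonnegative \<open>x\<close>
  this is the inequality behind Hoeffding's lemma at probability 1/2 and width \<open>2 * x\<close>;
  the other case follows by symmetry.\<close>

lemma exp_plus_exp_minus_le: "exp (- x) + exp x \<le> 2 * exp (x\<^sup>2 / 2)" for x :: real
proof -
  have pos: "exp (- x) + exp x \<le> 2 * exp (x\<^sup>2 / 2)" if "x \<ge> 0" for x :: real
  proof -
    have p: "(1 + exp (2 * x)) / 2 > 0" by (simp add: add_pos_pos)
    have "- (2 * x) * (1 / 2) + ln (1 + 1 / 2 * (exp (2 * x) - 1)) \<le> (2 * x)\<^sup>2 / 8"
      by (rule Hoeffdings_lemma_aux) (use that in auto)
    moreover have e: "1 + 1 / 2 * (exp (2 * x) - 1) = (1 + exp (2 * x)) / 2" by argo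
    ultimately have "ln ((1 + exp (2 * x)) / 2) \<le> x + x\<^sup>2 / 2"
      unfolding e by (simp add: power2_eq_square)
    then have "(1 + exp (2 * x)) / 2 \<le> exp (x + x\<^sup>2 / 2)" using p by (metis exp_le_cancel_iff exp_ln)
    then have "exp (- x) * (1 + exp (2 * x)) \<le> exp (- x) * (2 * exp (x + x\<^sup>2 / 2))"
      by (intro mult_left_mono) auto
    moreover have "exp (- x) * (2 * exp (x + x\<^sup>2 / 2)) = 2 * exp (x\<^sup>2 / 2)"
      by (simp add: exp_add exp_minus)
    ultimately show ?thesis by (simp add: distrib_left flip: exp_add)
  qed
  show ?thesis
  proof (cases "x \<ge> 0")
    case False
    then show ?thesis using pos[of "- x"] by simp
  qed (rule pos)
qed

lemma map_pmf_involution: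
  assumes "\<And>x. g (g x) = x" "\<And>x. pmf p (g x) = pmf p x"
  shows "map_pmf g p = p"
proof (rule pmf_eqI)
  fix x
  have "inj g" using assms(1) by (metis injI)
  then have "pmf (map_pmf g p) (g (g x)) = pmf p (g x)" by (rule pmf_map_inj')
  then show "pmf (map_pmf g p) x = pmf p x" by (simp add: assms)
qed

text \<open>Exchanging two samples at the positions in \<tau> flips the signs of the corresponding
  terms in their difference. Summing over all \<tau> thus plays the role of averaging over
  Rademacher signs.\<close>

definition swap_samples :: "nat set \<Rightarrow> (nat \<Rightarrow> 'z) \<times> (nat \<Rightarrow> 'z) \<Rightarrow> (nat \<Rightarrow> 'z) \<times> (nat \<Rightarrow> 'z)" where
  "swap_samples \<tau> w = ((\<lambda>i. if i \<in> \<tau> then snd w i else fst w i), (\<lambda>i. if i \<in> \<tau> then fst w i else snd w i))"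

lemma map_swap_samples_pair_Pi_pmf:
  assumes "\<tau> \<subseteq> {..<n}"
  shows "map_pmf (swap_samples \<tau>) (pair_pmf (Pi_pmf {..<n} dflt (\<lambda>_. D)) (Pi_pmf {..<n} dflt (\<lambda>_. D))) =
    pair_pmf (Pi_pmf {..<n} dflt (\<lambda>_. D)) (Pi_pmf {..<n} dflt (\<lambda>_. D))"
proof (rule map_pmf_involution)
  show "swap_samples \<tau> (swap_samples \<tau> w) = w" for w :: "(nat \<Rightarrow> 'a) \<times> (nat \<Rightarrow> 'a)"
    by (simp add: swap_samples_def fun_eq_iff prod_eq_iff)
  fix w :: "(nat \<Rightarrow> 'a) \<times> (nat \<Rightarrow> 'a)"
  obtain S T where w: "w = (S, T)" by (cases w)
  show "pmf (pair_pmf (Pi_pmf {..<n} dflt (\<lambda>_. D)) (Pi_pmf {..<n} dflt (\<lambda>_. D))) (swap_samples \<tau> w) =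
    pmf (pair_pmf (Pi_pmf {..<n} dflt (\<lambda>_. D)) (Pi_pmf {..<n} dflt (\<lambda>_. D))) w"
  \<comment> \<open>Otherwise \<open>S\<close> or \<open>T\<close> deviates from \<open>dflt\<close>
    at a position that \<tau> does not touch, and both densities are 0.\<close>
  proof (cases "\<forall>x. x \<notin> {..<n} \<longrightarrow> S x = dflt \<and> T x = dflt")
    case True
    have "(\<Prod>x<n. pmf D (if x \<in> \<tau> then T x else S x)) * (\<Prod>x<n. pmf D (if x \<in> \<tau> then S x else T x))
      = (\<Prod>x<n. pmf D (S x)) * (\<Prod>x<n. pmf D (T x))"
      unfolding prod.distrib[symmetric] by (intro prod.cong) auto
    moreover have "x \<notin> \<tau>" if "x \<notin> {..<n}" for x using that assms by auto
    ultimately show ?thesis using True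
      unfolding w swap_samples_def pmf_pair pmf_Pi[OF finite_lessThan] fst_conv snd_conv by simp
  next
    case False
    then obtain x where x: "x \<notin> {..<n}" "S x \<noteq> dflt \<or> T x \<noteq> dflt" by auto
    then have "x \<notin> \<tau>" using assms by auto
    then show ?thesis using x by (auto simp: w swap_samples_def pmf_pair pmf_Pi)
  qed
qed

text \<open>Exponentiating before symmetrizing avoids a lower bound on
  \<open>n * \<epsilon>\<^sup>2\<close>: a bad sample forces the exponential moment over a ghost
  sample to be at least \<open>exp (n * \<epsilon>\<^sup>2)\<close>, while averaging over swaps
  bounds its mean by \<open>G * exp (n * \<epsilon>\<^sup>2 / 2)\<close>.\<close>

theorem symmetrization_bound:
  fixes D :: "'z pmf" and F :: "('z \<Rightarrow> real) set" and \<epsilon> G :: real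
  assumes n: "n \<ge> 1" and fin: "finite (set_pmf D)" and \<epsilon>: "\<epsilon> \<ge> 0"
    and bnd: "\<And>f z z'. f \<in> F \<Longrightarrow> z \<in> set_pmf D \<Longrightarrow> z' \<in> set_pmf D \<Longrightarrow> \<bar>f z' - f z\<bar> \<le> 1"
    and growth: "\<And>Z. Z \<subseteq> set_pmf D \<Longrightarrow> card Z \<le> 2 * n \<Longrightarrow>
        finite ((\<lambda>f. restrict f Z) ` F) \<and> real (card ((\<lambda>f. restrict f Z) ` F)) \<le> G"
  shows "measure_pmf.prob (Pi_pmf {..<n} dflt (\<lambda>_. D))
      {S. \<exists>f\<in>F. measure_pmf.expectation D f - (1 / real n) * (\<Sum>i<n. f (S i)) > \<epsilon>}
    \<le> G * exp (- (real n * \<epsilon>\<^sup>2 / 2))"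
proof -
  define Q where "Q = Pi_pmf {..<n} dflt (\<lambda>_. D)"
  define pts where "pts S T = S ` {..<n} \<union> T ` {..<n}" for S T :: "nat \<Rightarrow> 'z"
  define pat where "pat Z = (\<lambda>f. restrict f Z) ` F" for Z
  \<comment> \<open>The sum over restrictions to the drawn points dominates the supremum over
    \<open>F\<close>. The weight \<epsilon> in the exponent is the minimizer
    \<open>l = \<epsilon>\<close> of \<open>n * (l\<^sup>2 / 2 - l * \<epsilon>)\<close>.\<close>
  define \<Phi> where "\<Phi> S T = (\<Sum>g\<in>pat (pts S T). exp (\<epsilon> * (\<Sum>i<n. g (T i) - g (S i))))" for S T
  define bad where "bad = {S. \<exists>f\<in>F. measure_pmf.expectation D f - (1 / real n) * (\<Sum>i<n. f (S i)) > \<epsilon>}"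
  have setQ: "set_pmf Q = PiE_dflt {..<n} dflt (\<lambda>_. set_pmf D)"
    unfolding Q_def by (subst set_Pi_pmf) (auto simp: o_def)
  have finQ: "finite (set_pmf Q)" unfolding setQ using fin by auto
  have inD: "S i \<in> set_pmf D" if "S \<in> set_pmf Q" "i < n" for S i
    using that by (auto simp: setQ PiE_dflt_def)
  have int: "integrable (measure_pmf Q) g" for g :: "_ \<Rightarrow> real"
    using finQ by (rule integrable_measure_pmf_finite)
  have pts: "pts S T \<subseteq> set_pmf D" "card (pts S T) \<le> 2 * n" if "S \<in> set_pmf Q" "T \<in> set_pmf Q" for S T
  proof -
    show "pts S T \<subseteq> set_pmf D" using inD that by (auto simp: pts_def)
    have "card (pts S T) \<le> card (S ` {..<n}) + card (T ` {..<n})"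
      unfolding pts_def by (rule card_Un_le)
    also have "\<dots> \<le> n + n" by (intro add_mono order_trans[OF card_image_le]) auto
    finally show "card (pts S T) \<le> 2 * n" by simp
  qed
  have mean: "measure_pmf.expectation Q (\<lambda>T. f (T i)) = measure_pmf.expectation D f" if "i < n" for f :: "'z \<Rightarrow> real" and i
  proof -
    have "map_pmf (\<lambda>T. T i) Q = D" unfolding Q_def using that by (subst Pi_pmf_component) auto
    have "measure_pmf.expectation Q (\<lambda>T. f (T i)) = measure_pmf.expectation (map_pmf (\<lambda>T. T i) Q) f"
      by simp
    then show ?thesis unfolding \<open>map_pmf _ _ = _\<close> .
  qed
  \<comment> \<open>For the offending \<open>f\<close> the mean over the ghost sample
    \<open>T\<close> of the exponent is at least \<open>n * \<epsilon>\<^sup>2\<close>, and Jensen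
    moves this mean outside \<open>exp\<close>.\<close>
  have step1: "exp (real n * \<epsilon>\<^sup>2) \<le> measure_pmf.expectation Q (\<Phi> S)" if S: "S \<in> set_pmf Q" "S \<in> bad" for S
  proof -
    from S obtain f where f: "f \<in> F" "measure_pmf.expectation D f - (1 / real n) * (\<Sum>i<n. f (S i)) > \<epsilon>"
      by (auto simp: bad_def)
    have "measure_pmf.expectation Q (\<lambda>T. \<epsilon> * (\<Sum>i<n. f (T i) - f (S i)))
      = \<epsilon> * (\<Sum>i<n. measure_pmf.expectation D f - f (S i))"
      using mean by (simp add: int)
    also have "\<dots> = \<epsilon> * (real n * (measure_pmf.expectation D f - (1 / real n) * (\<Sum>i<n. f (S i))))"
      using n by (simp add: sum_subtractf field_simps)
    also have "\<dots> \<ge> \<epsilon> * (real n * \<epsilon>)"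
      using f(2) \<epsilon> by (intro mult_left_mono) auto
    finally have "exp (real n * \<epsilon>\<^sup>2) \<le> exp (measure_pmf.expectation Q (\<lambda>T. \<epsilon> * (\<Sum>i<n. f (T i) - f (S i))))"
      by (simp add: power2_eq_square mult_ac)
    also have "\<dots> \<le> measure_pmf.expectation Q (\<lambda>T. exp (\<epsilon> * (\<Sum>i<n. f (T i) - f (S i))))"
      by (rule exp_expectation_le[OF finQ])
    also have "\<dots> \<le> measure_pmf.expectation Q (\<Phi> S)"
    proof (rule expectation_pmf_mono[OF finQ])
      fix T assume T: "T \<in> set_pmf Q"
      define g where "g = restrict f (pts S T)"
      have "finite (pat (pts S T))" using growth[OF pts[OF S(1) T]] by (simp add: pat_def)
      moreover have "g \<in> pat (pts S T)" using f(1) by (simp add: pat_def g_def)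
      ultimately have "exp (\<epsilon> * (\<Sum>i<n. g (T i) - g (S i))) \<le> \<Phi> S T"
        unfolding \<Phi>_def by (intro member_le_sum[where f = "\<lambda>g. exp (\<epsilon> * (\<Sum>i<n. g (T i) - g (S i)))"]) auto
      then show "exp (\<epsilon> * (\<Sum>i<n. f (T i) - f (S i))) \<le> \<Phi> S T" by (simp add: g_def pts_def)
    qed
    finally show ?thesis .
  qed
  have \<Phi>_nonneg: "\<Phi> S T \<ge> 0" for S T unfolding \<Phi>_def by (intro sum_nonneg) auto
  have "measure_pmf.prob Q bad = measure_pmf.expectation Q (indicat_real bad)" by simp
  \<comment> \<open>Markov's inequality, written as a pointwise bound of the indicator.\<close>
  also have "\<dots> \<le> measure_pmf.expectation Q (\<lambda>S. exp (- (real n * \<epsilon>\<^sup>2)) * measure_pmf.expectation Q (\<Phi> S))"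
  proof (rule expectation_pmf_mono[OF finQ])
    fix S assume S: "S \<in> set_pmf Q"
    have "0 \<le> measure_pmf.expectation Q (\<Phi> S)" by (simp add: \<Phi>_nonneg)
    moreover have "1 \<le> exp (- (real n * \<epsilon>\<^sup>2)) * measure_pmf.expectation Q (\<Phi> S)" if "S \<in> bad"
    proof -
      have "exp (- (real n * \<epsilon>\<^sup>2)) * exp (real n * \<epsilon>\<^sup>2) \<le> exp (- (real n * \<epsilon>\<^sup>2)) * measure_pmf.expectation Q (\<Phi> S)"
        using step1[OF S that] by (intro mult_left_mono) auto
      then show ?thesis by (simp flip: exp_add)
    qed
    ultimately show "indicat_real bad S \<le> exp (- (real n * \<epsilon>\<^sup>2)) * measure_pmf.expectation Q (\<Phi> S)"
      by (auto simp: indicator_def)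
  qed
  also have "\<dots> = exp (- (real n * \<epsilon>\<^sup>2)) * measure_pmf.expectation (pair_pmf Q Q) (\<lambda>w. \<Phi> (fst w) (snd w))"
    by (simp add: expectation_pair_pmf_finite[OF finQ finQ])
  finally have step2: "measure_pmf.prob Q bad \<le>
    exp (- (real n * \<epsilon>\<^sup>2)) * measure_pmf.expectation (pair_pmf Q Q) (\<lambda>w. \<Phi> (fst w) (snd w))" .
  let ?E = "measure_pmf.expectation (pair_pmf Q Q)"
  have finQQ: "finite (set_pmf (pair_pmf Q Q))" using finQ by simp
  have intQQ: "integrable (measure_pmf (pair_pmf Q Q)) g" for g :: "_ \<Rightarrow> real"
    using finQQ by (rule integrable_measure_pmf_finite)
  define \<Psi> where "\<Psi> \<tau> w = \<Phi> (fst (swap_samples \<tau> w)) (snd (swap_samples \<tau> w))" for \<tau> w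
  have swap: "?E (\<Psi> \<tau>) = ?E (\<lambda>w. \<Phi> (fst w) (snd w))" if "\<tau> \<in> Pow {..<n}" for \<tau>
  proof -
    have "map_pmf (swap_samples \<tau>) (pair_pmf Q Q) = pair_pmf Q Q"
      unfolding Q_def by (rule map_swap_samples_pair_Pi_pmf) (use that in auto)
    then have "?E (\<lambda>w. \<Phi> (fst w) (snd w)) =
      measure_pmf.expectation (map_pmf (swap_samples \<tau>) (pair_pmf Q Q)) (\<lambda>w. \<Phi> (fst w) (snd w))" by simp
    also have "\<dots> = ?E (\<Psi> \<tau>)" by (simp add: \<Psi>_def[abs_def])
    finally show ?thesis ..
  qed
  \<comment> \<open>All \<open>2 ^ n\<close> swaps leave the expectation unchanged, so it equals
    their average; below, the sum over swaps is bounded for each fixed pair of samples.\<close>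
  have "2 ^ n * ?E (\<lambda>w. \<Phi> (fst w) (snd w)) = (\<Sum>\<tau>\<in>Pow {..<n}. ?E (\<Psi> \<tau>))"
    using swap by (simp add: card_Pow)
  also have "\<dots> = ?E (\<lambda>w. \<Sum>\<tau>\<in>Pow {..<n}. \<Psi> \<tau> w)"
    by (subst Bochner_Integration.integral_sum) (auto simp: intQQ)
  also have "\<dots> \<le> ?E (\<lambda>w. G * (2 ^ n * exp (real n * \<epsilon>\<^sup>2 / 2)))"
  proof (rule expectation_pmf_mono[OF finQQ])
    fix w assume w: "w \<in> set_pmf (pair_pmf Q Q)"
    obtain S T where ST: "w = (S, T)" "S \<in> set_pmf Q" "T \<in> set_pmf Q" using w by auto
    define Z where "Z = pts S T"
    have \<Delta>: "\<bar>g (T i) - g (S i)\<bar> \<le> 1" if g: "g \<in> pat Z" and i: "i < n" for g i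
    proof -
      obtain f where "f \<in> F" "g = restrict f Z" using g unfolding pat_def by blast
      then show ?thesis using bnd inD ST i by (auto simp: Z_def pts_def)
    qed
    have "(\<Sum>\<tau>\<in>Pow {..<n}. \<Psi> \<tau> w) =
      (\<Sum>\<tau>\<in>Pow {..<n}. \<Sum>g\<in>pat Z. (\<Prod>i\<in>\<tau>. exp (- (\<epsilon> * (g (T i) - g (S i))))) *
          (\<Prod>i\<in>{..<n}-\<tau>. exp (\<epsilon> * (g (T i) - g (S i)))))"
    proof (intro sum.cong refl)
      fix \<tau> assume \<tau>: "\<tau> \<in> Pow {..<n}"
      \<comment> \<open>Swapping does not change the set of points of both samples together, so the
        same finite class \<open>pat Z\<close> serves every \<tau>.\<close>
      have "pts (fst (swap_samples \<tau> w)) (snd (swap_samples \<tau> w)) = Z"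
      proof -
        have "pts A B = (\<Union>i<n. {A i, B i})" for A B by (auto simp: pts_def)
        then show ?thesis unfolding Z_def ST swap_samples_def by auto
      qed
      then have "\<Psi> \<tau> w = (\<Sum>g\<in>pat Z. exp (\<Sum>i<n. \<epsilon> * (if i \<in> \<tau> then g (S i) - g (T i) else g (T i) - g (S i))))"
        unfolding \<Psi>_def \<Phi>_def by (auto simp: swap_samples_def ST sum_distrib_left intro!: sum.cong)
      also have "\<dots> = (\<Sum>g\<in>pat Z. (\<Prod>i\<in>\<tau>. exp (- (\<epsilon> * (g (T i) - g (S i))))) *
          (\<Prod>i\<in>{..<n}-\<tau>. exp (\<epsilon> * (g (T i) - g (S i)))))"
      proof (intro sum.cong refl)
        fix g assume "g \<in> pat Z"
        have "(\<Prod>i<n. exp (\<epsilon> * (if i \<in> \<tau> then g (S i) - g (T i) else g (T i) - g (S i)))) =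
          (\<Prod>i\<in>{..<n}-\<tau>. exp (\<epsilon> * (if i \<in> \<tau> then g (S i) - g (T i) else g (T i) - g (S i)))) *
          (\<Prod>i\<in>\<tau>. exp (\<epsilon> * (if i \<in> \<tau> then g (S i) - g (T i) else g (T i) - g (S i))))"
          using \<tau> by (intro prod.subset_diff) auto
        also have "\<dots> = (\<Prod>i\<in>{..<n}-\<tau>. exp (\<epsilon> * (g (T i) - g (S i)))) *
          (\<Prod>i\<in>\<tau>. exp (- (\<epsilon> * (g (T i) - g (S i)))))"
          by (intro arg_cong2[where f = "(*)"] prod.cong) (auto simp: algebra_simps)
        finally show "exp (\<Sum>i<n. \<epsilon> * (if i \<in> \<tau> then g (S i) - g (T i) else g (T i) - g (S i))) =
          (\<Prod>i\<in>\<tau>. exp (- (\<epsilon> * (g (T i) - g (S i))))) * (\<Prod>i\<in>{..<n}-\<tau>. exp (\<epsilon> * (g (T i) - g (S i))))"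
          by (simp add: exp_sum mult.commute)
      qed
      finally show "\<Psi> \<tau> w = \<dots>" .
    qed
    \<comment> \<open>The sum over subsets \<tau> is the expansion of a product of two-term sums,
      one factor per position.\<close>
    also have "\<dots> = (\<Sum>g\<in>pat Z. \<Prod>i<n. exp (- (\<epsilon> * (g (T i) - g (S i)))) + exp (\<epsilon> * (g (T i) - g (S i))))"
      by (subst sum.swap) (simp add: prod_add)
    also have "\<dots> \<le> (\<Sum>g\<in>pat Z. 2 ^ n * exp (real n * \<epsilon>\<^sup>2 / 2))"
    proof (rule sum_mono)
      fix g assume g: "g \<in> pat Z"
      have "(\<Prod>i<n. exp (- (\<epsilon> * (g (T i) - g (S i)))) + exp (\<epsilon> * (g (T i) - g (S i))))
        \<le> (\<Prod>i<n. 2 * exp (\<epsilon>\<^sup>2 / 2))"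
      proof (intro prod_mono conjI)
        fix i assume i: "i \<in> {..<n}"
        have "(g (T i) - g (S i))\<^sup>2 \<le> 1" using \<Delta>[OF g] i by (auto simp: abs_square_le_1)
        then have "(\<epsilon> * (g (T i) - g (S i)))\<^sup>2 \<le> \<epsilon>\<^sup>2 * 1"
          unfolding power_mult_distrib by (intro mult_left_mono) auto
        then show "exp (- (\<epsilon> * (g (T i) - g (S i)))) + exp (\<epsilon> * (g (T i) - g (S i))) \<le> 2 * exp (\<epsilon>\<^sup>2 / 2)"
          using exp_plus_exp_minus_le[of "\<epsilon> * (g (T i) - g (S i))"]
          by (smt (verit) exp_le_cancel_iff divide_right_mono)
      qed (auto intro: add_nonneg_nonneg)
      also have "\<dots> = 2 ^ n * exp (real n * \<epsilon>\<^sup>2 / 2)"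
        by (simp add: power_mult_distrib exp_of_nat_mult[symmetric])
      finally show "(\<Prod>i<n. exp (- (\<epsilon> * (g (T i) - g (S i)))) + exp (\<epsilon> * (g (T i) - g (S i)))) \<le> \<dots>" .
    qed
    also have "\<dots> = real (card (pat Z)) * (2 ^ n * exp (real n * \<epsilon>\<^sup>2 / 2))" by simp
    also have "\<dots> \<le> G * (2 ^ n * exp (real n * \<epsilon>\<^sup>2 / 2))"
      using growth[OF pts[OF ST(2,3)]] by (intro mult_right_mono) (auto simp: pat_def Z_def)
    finally show "(\<Sum>\<tau>\<in>Pow {..<n}. \<Psi> \<tau> w) \<le> G * (2 ^ n * exp (real n * \<epsilon>\<^sup>2 / 2))" .
  qed
  finally have "2 ^ n * ?E (\<lambda>w. \<Phi> (fst w) (snd w)) \<le> 2 ^ n * (G * exp (real n * \<epsilon>\<^sup>2 / 2))"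
    by (simp add: mult_ac)
  then have step3: "?E (\<lambda>w. \<Phi> (fst w) (snd w)) \<le> G * exp (real n * \<epsilon>\<^sup>2 / 2)" by simp
  have "measure_pmf.prob Q bad \<le> exp (- (real n * \<epsilon>\<^sup>2)) * (G * exp (real n * \<epsilon>\<^sup>2 / 2))"
    by (rule order_trans[OF step2 mult_left_mono[OF step3]]) simp
  also have "\<dots> = G * exp (- (real n * \<epsilon>\<^sup>2 / 2))"
    by (simp add: field_simps flip: exp_add)
  finally show ?thesis by (simp add: Q_def bad_def)
qed

section \<open>Counting predictors on a finite set of inputs\<close>

lemma predictor_determined:
  assumes "\<And>l k. l < p \<Longrightarrow> k < p \<Longrightarrow>
      score \<sigma> p d W V x l > score \<sigma> p d W V x k \<longleftrightarrow> score \<sigma> p d W' V' x l > score \<sigma> p d W' V' x k"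
  shows "predictor \<sigma> p d W V x = predictor \<sigma> p d W' V' x"
proof -
  have "(\<lambda>l. l < p \<and> (\<forall>k<p. k \<noteq> l \<longrightarrow> score \<sigma> p d W V x l > score \<sigma> p d W V x k)) =
    (\<lambda>l. l < p \<and> (\<forall>k<p. k \<noteq> l \<longrightarrow> score \<sigma> p d W' V' x l > score \<sigma> p d W' V' x k))"
    using assms by auto
  then show ?thesis by (simp only: predictor_def)
qed

lemma card_range_determined_le:
  assumes "finite C" "range \<pi> \<subseteq> C" "\<And>a b. \<pi> a = \<pi> b \<Longrightarrow> h a = h b"
  shows "finite (range h) \<and> card (range h) \<le> card C"
proof -
  have "h a = h (inv \<pi> (\<pi> a))" for a by (rule assms(3)) (simp add: f_inv_into_f)
  then have "range h \<subseteq> (\<lambda>s. h (inv \<pi> s)) ` C" using assms(2) by blast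
  then show ?thesis using assms(1)
    by (meson card_image_le card_mono finite_imageI finite_subset order_trans)
qed

text \<open>The variable \<open>(0, j, l)\<close> stands for \<open>V l j\<close>; \<open>(1, j, i)\<close> and \<open>(2, j, i)\<close> stand for \<open>W j i\<close> or for
  functions of it that depend on the activation.\<close>

definition param_index :: "nat \<Rightarrow> nat \<Rightarrow> (nat \<times> nat \<times> nat) set" where
  "param_index p d = {..<3} \<times> {..<d} \<times> {..<p}"

lemma finite_param_index [simp]: "finite (param_index p d)"
  by (simp add: param_index_def)

lemma card_param_index: "card (param_index p d) = 3 * (d * p)"
  by (simp add: param_index_def card_cartesian_product)

text \<open>The polynomials \<open>g\<close> select the pieces of a piecewise activation: \<open>num\<close> may depend on their
  positivity pattern.\<close>

lemma card_predictor_restrictions_le: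
  fixes p d m \<kappa> :: nat and A :: "(nat \<Rightarrow> nat) set" and K1 :: "'k set"
    and enc :: "(nat \<Rightarrow> nat \<Rightarrow> real) \<Rightarrow> (nat \<Rightarrow> nat \<Rightarrow> real) \<Rightarrow> (nat \<times> nat \<times> nat \<Rightarrow> real)"
  defines "I \<equiv> param_index p d"
  assumes fin: "finite A" "finite K1" and pos: "p \<ge> 1" "d \<ge> 1" "m \<ge> 1"
    and K1: "card K1 \<le> \<kappa> * (card A * d)"
    and g: "\<And>k. k \<in> K1 \<Longrightarrow> g k \<in> poly_fun I 1"
    and num: "\<And>s x j. s \<subseteq> K1 \<Longrightarrow> x \<in> A \<Longrightarrow> j < d \<Longrightarrow> num s x j \<in> poly_fun I (\<kappa> * (1 + m))"
    and den: "\<And>x j. x \<in> A \<Longrightarrow> j < d \<Longrightarrow> den x j \<in> poly_fun I m"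
    and den_pos: "\<And>W V x j. x \<in> A \<Longrightarrow> j < d \<Longrightarrow> den x j (enc W V) > 0"
    and enc: "\<And>W V j l. enc W V (0, j, l) = V l j"
    and \<sigma>: "\<And>W V x j. x \<in> A \<Longrightarrow> j < d \<Longrightarrow> \<sigma> (\<Sum>k<p. W j k * real (x k)) =
        num {k\<in>K1. g k (enc W V) > 0} x j (enc W V) / den x j (enc W V)"
  shows "finite (range (\<lambda>(W, V). restrict (predictor \<sigma> p d W V) A)) \<and>
    card (range (\<lambda>(W, V). restrict (predictor \<sigma> p d W V) A))
      \<le> ((31 + 12 * \<kappa>) * (d + p + m + card A) ^ 7) ^ (6 * (d * p))"
proof -
  define K2 where "K2 = A \<times> {..<p} \<times> {..<p}"
  \<comment> \<open>The difference of the scores \<open>l\<close> and \<open>k\<close> at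
    \<open>x\<close>, multiplied by all denominators of the hidden units. Their product is positive
    at encoded parameters, so the sign is that of the score difference.\<close>
  define f where "f s = (\<lambda>(x, l, k) z. \<Sum>j<d. (z (0, j, l) - z (0, j, k)) *
      (num s x j z * (\<Prod>i\<in>{..<d} - {j}. den x i z)))" for s
  \<comment> \<open>Degree 1 from the output weights, \<open>\<kappa> * (1 + m)\<close> from one
    numerator, and at most \<open>d * m\<close> from the remaining denominators.\<close>
  define D where "D = 1 + (\<kappa> * (1 + m) + d * m)"
  have finI: "finite I" by (simp add: I_def)
  have f: "f s k \<in> poly_fun I D" if "s \<subseteq> K1" "k \<in> K2" for s k
  proof -
    obtain x l k' where k: "k = (x, l, k')" "x \<in> A" "l < p" "k' < p"
      using \<open>k \<in> K2\<close> by (auto simp: K2_def)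
    have "(\<lambda>z. (z (0, j, l) - z (0, j, k')) * (num s x j z * (\<Prod>i\<in>{..<d} - {j}. den x i z))) \<in> poly_fun I D"
      if j: "j < d" for j
    proof -
      have "(\<lambda>z. \<Prod>i\<in>{..<d} - {j}. den x i z) \<in> poly_fun I (\<Sum>i\<in>{..<d} - {j}. m)"
        by (rule poly_fun_prod[OF finI]) (use den k in auto)
      then have "(\<lambda>z. \<Prod>i\<in>{..<d} - {j}. den x i z) \<in> poly_fun I (d * m)"
        by (rule poly_fun_mono[OF finI]) (use card_mono[of "{..<d}" "{..<d} - {j}"] in auto)
      then show ?thesis unfolding D_def
        using j k \<open>s \<subseteq> K1\<close>
        by (intro poly_fun_mult[OF finI] poly_fun_diff poly_fun_var[OF finI] num)
          (auto simp: I_def param_index_def)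
    qed
    then show ?thesis unfolding f_def k prod.case by (intro poly_fun_sum) auto
  qed
  have f_pos: "f {k\<in>K1. g k (enc W V) > 0} (x, l, k) (enc W V) > 0 \<longleftrightarrow>
      score \<sigma> p d W V x l > score \<sigma> p d W V x k"
    if "(x, l, k) \<in> K2" for W V x l k
  proof -
    let ?z = "enc W V" and ?s = "{k\<in>K1. g k (enc W V) > 0}"
    have x: "x \<in> A" using that by (simp add: K2_def)
    have P: "(\<Prod>i<d. den x i ?z) > 0" using den_pos x by (intro prod_pos) auto
    have "f ?s (x, l, k) ?z = (\<Sum>j<d. (\<Prod>i<d. den x i ?z) * ((V l j - V k j) * \<sigma> (\<Sum>k<p. W j k * real (x k))))"
      unfolding f_def prod.case
    proof (intro sum.cong refl)
      fix j assume j: "j \<in> {..<d}"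
      have "(\<Prod>i<d. den x i ?z) = den x j ?z * (\<Prod>i\<in>{..<d} - {j}. den x i ?z)"
        using j by (simp add: prod.remove)
      moreover have "den x j ?z \<noteq> 0" using den_pos[OF x, of j W V] j by auto
      moreover have "\<sigma> (\<Sum>k<p. W j k * real (x k)) = num ?s x j ?z / den x j ?z"
        using \<sigma>[OF x, of j W V] j by simp
      ultimately show "(?z (0, j, l) - ?z (0, j, k)) * (num ?s x j ?z * (\<Prod>i\<in>{..<d} - {j}. den x i ?z)) =
        (\<Prod>i<d. den x i ?z) * ((V l j - V k j) * \<sigma> (\<Sum>k<p. W j k * real (x k)))"
        by (simp add: enc)
    qed
    also have "\<dots> = (\<Prod>i<d. den x i ?z) * (score \<sigma> p d W V x l - score \<sigma> p d W V x k)"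
      by (simp add: score_def sum_distrib_left sum_subtractf algebra_simps)
    finally show ?thesis using P by (simp add: zero_less_mult_iff)
  qed
  \<comment> \<open>The count has two stages: the pattern \<open>s\<close> of the selecting
    polynomials fixes the family \<open>f s\<close>, whose patterns are then counted separately for
    each \<open>s\<close>.\<close>
  define R1 where "R1 = range (\<lambda>z. {k\<in>K1. g k z > 0})"
  define R2 where "R2 s = range (\<lambda>z. {k\<in>K2. f s k z > 0})" for s
  define \<pi> where "\<pi> = (\<lambda>(W, V). ({k\<in>K1. g k (enc W V) > 0},
      {k\<in>K2. f {k\<in>K1. g k (enc W V) > 0} k (enc W V) > 0}))"
  have finK2: "finite K2" by (simp add: K2_def fin)
  have R1: "R1 \<subseteq> Pow K1" and R2: "R2 s \<subseteq> Pow K2" for s by (auto simp: R1_def R2_def)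
  have finR1: "finite R1" by (rule finite_subset[OF R1]) (simp add: fin)
  have finR2: "finite (R2 s)" for s by (rule finite_subset[OF R2]) (simp add: finK2)
  have "finite (Sigma R1 R2)" using finR1 finR2 by auto
  moreover have "range \<pi> \<subseteq> Sigma R1 R2" by (auto simp: \<pi>_def R1_def R2_def)
  moreover have "(\<lambda>(W, V). restrict (predictor \<sigma> p d W V) A) a = (\<lambda>(W, V). restrict (predictor \<sigma> p d W V) A) b"
    if "\<pi> a = \<pi> b" for a b
  proof -
    obtain W V W' V' where ab: "a = (W, V)" "b = (W', V')" by (cases a, cases b)
    have "predictor \<sigma> p d W V x = predictor \<sigma> p d W' V' x" if "x \<in> A" for x
    proof (rule predictor_determined)
      fix l k assume "l < p" "k < p"
      then have K: "(x, l, k) \<in> K2" using that by (simp add: K2_def)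
      have "snd (\<pi> a) = snd (\<pi> b)" using \<open>\<pi> a = \<pi> b\<close> by simp
      then have "(x, l, k) \<in> snd (\<pi> a) \<longleftrightarrow> (x, l, k) \<in> snd (\<pi> b)" by simp
      then show "score \<sigma> p d W V x l > score \<sigma> p d W V x k \<longleftrightarrow> score \<sigma> p d W' V' x l > score \<sigma> p d W' V' x k"
        using K f_pos[OF K] by (simp add: \<pi>_def ab)
    qed
    then show ?thesis unfolding ab by (auto simp: restrict_def fun_eq_iff)
  qed
  ultimately have main: "finite (range (\<lambda>(W, V). restrict (predictor \<sigma> p d W V) A)) \<and>
    card (range (\<lambda>(W, V). restrict (predictor \<sigma> p d W V) A)) \<le> card (Sigma R1 R2)"
    by (rule card_range_determined_le)
  define c where "c = 3 * (d * p)"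
  define B1 where "B1 = (2 * c * (c + card K1 * 1) + 1) ^ c"
  define B2 where "B2 = (2 * c * (c + card K2 * D) + 1) ^ c"
  have "card (Sigma R1 R2) = (\<Sum>s\<in>R1. card (R2 s))" using finR1 finR2 by simp
  also have "\<dots> \<le> (\<Sum>s\<in>R1. B2)"
  proof (rule sum_mono)
    fix s assume "s \<in> R1"
    then have "s \<subseteq> K1" using R1 by auto
    then show "card (R2 s) \<le> B2"
      unfolding R2_def B2_def c_def card_param_index[symmetric] I_def[symmetric]
      by (intro card_positivity_patterns_le finI finK2 f)
  qed
  also have "\<dots> = card R1 * B2" by simp
  also have "\<dots> \<le> B1 * B2"
    unfolding R1_def B1_def c_def card_param_index[symmetric] I_def[symmetric]
    by (intro mult_right_mono card_positivity_patterns_le finI fin g) auto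
  also have "\<dots> \<le> ((31 + 12 * \<kappa>) * (d + p + m + card A) ^ 7) ^ c * ((31 + 12 * \<kappa>) * (d + p + m + card A) ^ 7) ^ c"
  proof -
    \<comment> \<open>A deliberately crude common bound, as only its logarithm matters later. With
      \<open>c\<close> at most \<open>3 * s ^ 2\<close>, \<open>card K2\<close> at most
      \<open>s ^ 3\<close> and \<open>D\<close> at most \<open>(2 + 2 * \<kappa>) * s ^ 2\<close>,
      the larger base is at most \<open>18 * s ^ 4 + (12 + 12 * \<kappa>) * s ^ 7 + 1\<close>,
      whence 31 = 18 + 12 + 1.\<close>
    define s where "s = d + p + m + card A"
    have le: "d \<le> s" "p \<le> s" "m \<le> s" "card A \<le> s" "1 \<le> s" using pos by (auto simp: s_def)
    have pw: "s ^ i \<le> s ^ 7" if "i \<le> 7" for i using le that by (intro power_increasing) auto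
    have c: "c \<le> 3 * s ^ 2" unfolding c_def power2_eq_square using le by (intro mult_mono) auto
    have a1: "2 * c * (c + card K1 * 1) + 1 \<le> (31 + 12 * \<kappa>) * s ^ 7"
    proof -
      have "card A * d \<le> s ^ 2" unfolding power2_eq_square using le by (intro mult_mono) auto
      then have "card K1 \<le> \<kappa> * s ^ 2" using K1 by (meson le_trans mult_le_mono2)
      then have "c + card K1 * 1 \<le> 3 * s ^ 2 + \<kappa> * s ^ 2" using c by simp
      then have "2 * c * (c + card K1 * 1) + 1 \<le> 2 * (3 * s ^ 2) * (3 * s ^ 2 + \<kappa> * s ^ 2) + 1"
        using c by (intro add_right_mono mult_le_mono) auto
      also have "\<dots> = (18 + 6 * \<kappa>) * s ^ 4 + 1" by (simp add: algebra_simps power_numeral_reduce)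
      also have "\<dots> \<le> (18 + 6 * \<kappa>) * s ^ 7 + s ^ 7"
        using pw[of 4] pw[of 0] by (intro add_mono mult_left_mono) auto
      also have "\<dots> \<le> (31 + 12 * \<kappa>) * s ^ 7" by (simp add: algebra_simps)
      finally show ?thesis .
    qed
    have a2: "2 * c * (c + card K2 * D) + 1 \<le> (31 + 12 * \<kappa>) * s ^ 7"
    proof -
      have "card K2 = card A * (p * p)" by (simp add: K2_def card_cartesian_product)
      also have "\<dots> \<le> s * (s * s)" using le by (intro mult_mono) auto
      finally have k2: "card K2 \<le> s ^ 3" by (simp add: power3_eq_cube)
      have "1 * 1 \<le> s * s" "m * 1 \<le> s * s" "d * m \<le> s * s" using le by (intro mult_le_mono; simp)+
      then have "D \<le> s ^ 2 + (\<kappa> * (s * s + s * s) + s * s)"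
        unfolding D_def power2_eq_square by (intro add_le_mono mult_le_mono2) simp_all
      then have D: "D \<le> (2 + 2 * \<kappa>) * s ^ 2" by (simp add: algebra_simps power2_eq_square)
      have "2 * c * (c + card K2 * D) + 1 \<le> 2 * (3 * s ^ 2) * (3 * s ^ 2 + s ^ 3 * ((2 + 2 * \<kappa>) * s ^ 2)) + 1"
        using c k2 D by (intro add_mono mult_mono) auto
      also have "\<dots> = 18 * s ^ 4 + (12 + 12 * \<kappa>) * s ^ 7 + 1"
        by (simp add: algebra_simps power_numeral_reduce)
      also have "\<dots> \<le> 18 * s ^ 7 + (12 + 12 * \<kappa>) * s ^ 7 + s ^ 7"
        using pw[of 4] pw[of 0] by (intro add_mono mult_left_mono) auto
      also have "\<dots> = (31 + 12 * \<kappa>) * s ^ 7" by (simp add: algebra_simps)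
      finally show ?thesis .
    qed
    show ?thesis unfolding B1_def B2_def s_def[symmetric] using a1 a2 by (intro mult_mono power_mono) auto
  qed
  also have "\<dots> = ((31 + 12 * \<kappa>) * (d + p + m + card A) ^ 7) ^ (6 * (d * p))"
    by (simp add: c_def flip: power_add)
  finally show ?thesis using main by simp
qed

section \<open>Representing the activations by polynomials in the parameters\<close>

text \<open>Once the piece of every preactivation is fixed, all scores are polynomials. The pieces
  are read off from the positivity of the linear forms \<open>pre x j z - b l\<close>, and strict
  positivity matches pieces that are open on the left and closed on the right.\<close>

lemma piecewise_poly_growth:
  assumes "piecewise_poly_act L r \<sigma>" "L \<ge> 1"
  shows "\<exists>\<kappa>. \<forall>p m d A. p \<ge> 1 \<longrightarrow> m \<ge> 1 \<longrightarrow> d \<ge> 1 \<longrightarrow> finite A \<longrightarrow>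
    finite (range (\<lambda>(W, V). restrict (predictor \<sigma> p d W V) A)) \<and>
    card (range (\<lambda>(W, V). restrict (predictor \<sigma> p d W V) A))
      \<le> ((31 + 12 * \<kappa>) * (d + p + m + card A) ^ 7) ^ (6 * (d * p))"
proof -
  from assms(1) obtain b :: "nat \<Rightarrow> real" and P :: "nat \<Rightarrow> real poly" where
    P: "\<And>l. l \<in> {1..L} \<Longrightarrow> degree (P l) \<le> r"
    "\<And>l t. l \<in> {1..L} \<Longrightarrow> (l = 1 \<or> b (l - 1) < t) \<and> (l = L \<or> t \<le> b l) \<Longrightarrow> \<sigma> t = poly (P l) t"
    unfolding piecewise_poly_act_def by blast
  \<comment> \<open>Applied to the set of indices whose breakpoints lie strictly below
    \<open>t\<close>, this is the first \<open>l\<close> with \<open>t\<close> at most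
    \<open>b l\<close>, or \<open>L\<close> if there is none. Minimality puts \<open>l - 1\<close>
    in the set, which gives \<open>b (l - 1) < t\<close>.\<close>
  define piece where "piece T = (LEAST l. 1 \<le> l \<and> (l = L \<or> l \<notin> T))" for T :: "nat set"
  have piece: "piece T \<in> {1..L}" "piece T = L \<or> piece T \<notin> T" "piece T = 1 \<or> piece T - 1 \<in> T" for T
  proof -
    let ?Q = "\<lambda>l. 1 \<le> l \<and> (l = L \<or> l \<notin> T)"
    have Q: "?Q (piece T)" unfolding piece_def by (rule LeastI[of ?Q L]) (use assms(2) in auto)
    have "piece T \<le> L" unfolding piece_def by (rule Least_le) (use assms(2) in auto)
    with Q show "piece T \<in> {1..L}" "piece T = L \<or> piece T \<notin> T" by auto
    show "piece T = 1 \<or> piece T - 1 \<in> T"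
    proof (rule ccontr)
      assume n: "\<not> ?thesis"
      then have "?Q (piece T - 1)" using Q by auto
      then have "piece T \<le> piece T - 1" unfolding piece_def by (rule Least_le)
      then show False using Q by auto
    qed
  qed
  show ?thesis
  \<comment> \<open>\<open>r\<close> accounts for the degree of the pieces and \<open>L\<close> for
    the number of breakpoint comparisons per preactivation.\<close>
  proof (rule exI[of _ "r + L"], intro allI impI)
    fix p m d :: nat and A :: "(nat \<Rightarrow> nat) set"
    assume h: "p \<ge> 1" "m \<ge> 1" "d \<ge> 1" "finite A"
    let ?I = "param_index p d"
    define pre where "pre x j z = (\<Sum>k<p. z (1, j, k) * real (x k))"
      for x :: "nat \<Rightarrow> nat" and j :: nat and z :: "nat \<times> nat \<times> nat \<Rightarrow> real"
    have pre: "pre x j \<in> poly_fun ?I 1" if "j < d" for x j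
    proof -
      have "(\<lambda>z. \<Sum>k<p. real (x k) * z (1, j, k)) \<in> poly_fun ?I 1"
        using that by (intro poly_fun_sum poly_fun_scale poly_fun_var) (auto simp: param_index_def)
      then show ?thesis by (rule poly_fun_cong) (simp add: pre_def mult.commute)
    qed
    define K1 where "K1 = A \<times> {..<d} \<times> {1..<L}"
    show "finite (range (\<lambda>(W, V). restrict (predictor \<sigma> p d W V) A)) \<and>
      card (range (\<lambda>(W, V). restrict (predictor \<sigma> p d W V) A))
        \<le> ((31 + 12 * (r + L)) * (d + p + m + card A) ^ 7) ^ (6 * (d * p))"
    proof (rule card_predictor_restrictions_le[where ?K1.0 = K1 and g = "\<lambda>(x, j, l) z. pre x j z - b l" and
          num = "\<lambda>s x j z. poly (P (piece {l. (x, j, l) \<in> s})) (pre x j z)" and den = "\<lambda>x j z. 1" and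
          enc = "\<lambda>W V (t, j, i). if t = 0 then V i j else W j i"])
      have "card K1 = card A * d * (L - 1)" by (simp add: K1_def card_cartesian_product)
      also have "\<dots> \<le> (r + L) * (card A * d)" by (subst mult.commute) (intro mult_mono, auto)
      finally show "card K1 \<le> (r + L) * (card A * d)" .
      show "(\<lambda>(x, j, l) z. pre x j z - b l) k \<in> poly_fun ?I 1" if "k \<in> K1" for k
        using that by (auto simp: K1_def intro!: poly_fun_diff pre[unfolded One_nat_def] poly_fun_const)
      show "(\<lambda>z. poly (P (piece {l. (x, j, l) \<in> s})) (pre x j z)) \<in> poly_fun ?I ((r + L) * (1 + m))"
        if "j < d" for s x j
      proof (rule poly_fun_mono[OF _ poly_fun_poly[OF _ pre[OF that]]])
        have "degree (P (piece {l. (x, j, l) \<in> s})) \<le> r" by (intro P(1) piece)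
        also have "r \<le> (r + L) * (1 + m)" by (simp add: algebra_simps)
        finally show "degree (P (piece {l. (x, j, l) \<in> s})) * 1 \<le> (r + L) * (1 + m)" by simp
      qed auto
      show "\<sigma> (\<Sum>k<p. W j k * real (x k)) =
        poly (P (piece {l. (x, j, l) \<in> {k \<in> K1. 0 < (case k of (x, j, l) \<Rightarrow> \<lambda>z. pre x j z - b l)
            (\<lambda>(t, j, i). if t = 0 then V i j else W j i)}}))
          (pre x j (\<lambda>(t, j, i). if t = 0 then V i j else W j i)) / 1"
        if x: "x \<in> A" "j < d" for W V x j
      proof -
        define t where "t = (\<Sum>k<p. W j k * real (x k))"
        have t: "pre x j (\<lambda>(t, j, i). if t = 0 then V i j else W j i) = t"
          by (simp add: pre_def t_def)
        have T: "{l. (x, j, l) \<in> {k \<in> K1. 0 < (case k of (x, j, l) \<Rightarrow> \<lambda>z. pre x j z - b l)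
            (\<lambda>(t, j, i). if t = 0 then V i j else W j i)}} = {l\<in>{1..<L}. b l < t}"
          using x t by (auto simp: K1_def)
        let ?T = "{l\<in>{1..<L}. b l < t}"
        have "\<sigma> t = poly (P (piece ?T)) t"
          by (rule P(2)[OF piece(1)]) (use piece[of ?T] in auto)
        then show ?thesis unfolding T t by (simp add: t_def)
      qed
    qed (use h in \<open>auto simp: K1_def intro: poly_fun_const\<close>)
  qed
qed

section \<open>Trigonometric activations in the cosines and sines of the weights\<close>

lemma cos_sin_multiple_poly_fun:
  assumes fin: "finite I" "u \<in> I" "v \<in> I"
  shows "\<exists>C\<in>poly_fun I n. \<exists>S\<in>poly_fun I n. \<forall>z t. z u = cos t \<and> z v = sin t \<longrightarrow>
    C z = cos (real n * t) \<and> S z = sin (real n * t)"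
proof (induction n)
  case 0
  show ?case
    by (rule bexI[of _ "\<lambda>_. 1"], rule bexI[of _ "\<lambda>_. 0"]) (auto intro!: poly_fun_const fin)
next
  case (Suc n)
  then obtain C S where C: "C \<in> poly_fun I n" and S: "S \<in> poly_fun I n"
    and CS: "\<And>z t. z u = cos t \<Longrightarrow> z v = sin t \<Longrightarrow> C z = cos (real n * t) \<and> S z = sin (real n * t)" by blast
  have var: "(\<lambda>z. z u) \<in> poly_fun I 1" "(\<lambda>z. z v) \<in> poly_fun I 1" using fin by (auto intro: poly_fun_var)
  have *: "(\<lambda>z. C z * z u - S z * z v) \<in> poly_fun I (n + 1)" "(\<lambda>z. S z * z u + C z * z v) \<in> poly_fun I (n + 1)"
    by (intro poly_fun_diff poly_fun_add poly_fun_mult fin C S var)+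
  have "C z * z u - S z * z v = cos (real (Suc n) * t) \<and> S z * z u + C z * z v = sin (real (Suc n) * t)"
    if "z u = cos t" "z v = sin t" for z t
  proof -
    have "real (Suc n) * t = real n * t + t" by (simp add: distrib_right)
    then show ?thesis using CS[OF that] that unfolding \<open>real (Suc n) * t = _\<close> cos_add sin_add by simp
  qed
  then show ?case
    using * by (intro bexI[of _ "\<lambda>z. C z * z u - S z * z v"] bexI[of _ "\<lambda>z. S z * z u + C z * z v"]) auto
qed

text \<open>The addition formulas, applied once per summand, add the degrees. For an input with
  entries summing to \<open>m\<close>, a frequency \<open>k\<close> therefore costs degree
  \<open>k * m\<close> regardless of \<open>p\<close>.\<close>

lemma cos_sin_integer_combination_poly_fun:
  fixes c :: "nat \<Rightarrow> nat" and p :: nat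
  assumes fin: "finite I" "\<And>k. k < p \<Longrightarrow> u k \<in> I" "\<And>k. k < p \<Longrightarrow> v k \<in> I"
  shows "\<exists>C\<in>poly_fun I (\<Sum>k<p. c k). \<exists>S\<in>poly_fun I (\<Sum>k<p. c k). \<forall>z w. (\<forall>k<p. z (u k) = cos (w k) \<and> z (v k) = sin (w k)) \<longrightarrow>
    C z = cos (\<Sum>k<p. real (c k) * w k) \<and> S z = sin (\<Sum>k<p. real (c k) * w k)"
  using fin(2,3)
proof (induction p)
  case 0
  show ?case
    by (rule bexI[of _ "\<lambda>_. 1"], rule bexI[of _ "\<lambda>_. 0"]) (auto intro!: poly_fun_const fin)
next
  case (Suc p)
  have uv: "\<And>k. k < p \<Longrightarrow> u k \<in> I" "\<And>k. k < p \<Longrightarrow> v k \<in> I" using Suc.prems by auto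
  from Suc.IH[OF this] obtain C S where C: "C \<in> poly_fun I (\<Sum>k<p. c k)" and S: "S \<in> poly_fun I (\<Sum>k<p. c k)"
    and CS: "\<And>z w. \<forall>k<p. z (u k) = cos (w k) \<and> z (v k) = sin (w k) \<Longrightarrow>
      C z = cos (\<Sum>k<p. real (c k) * w k) \<and> S z = sin (\<Sum>k<p. real (c k) * w k)"
    by blast
  obtain C' S' where C': "C' \<in> poly_fun I (c p)" and S': "S' \<in> poly_fun I (c p)"
    and CS': "\<And>z t. z (u p) = cos t \<Longrightarrow> z (v p) = sin t \<Longrightarrow> C' z = cos (real (c p) * t) \<and> S' z = sin (real (c p) * t)"
    using cos_sin_multiple_poly_fun[OF fin(1) Suc.prems(1)[of p] Suc.prems(2)[of p], of "c p"] by auto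
  have *: "(\<lambda>z. C z * C' z - S z * S' z) \<in> poly_fun I (\<Sum>k<Suc p. c k)"
      "(\<lambda>z. S z * C' z + C z * S' z) \<in> poly_fun I (\<Sum>k<Suc p. c k)"
    unfolding sum.lessThan_Suc by (intro poly_fun_diff poly_fun_add poly_fun_mult fin(1) C S C' S')+
  have "C z * C' z - S z * S' z = cos (\<Sum>k<Suc p. real (c k) * w k) \<and>
      S z * C' z + C z * S' z = sin (\<Sum>k<Suc p. real (c k) * w k)"
    if "\<forall>k<Suc p. z (u k) = cos (w k) \<and> z (v k) = sin (w k)" for z w
    using CS[of z w] CS'[of z "w p"] that by (simp add: cos_add sin_add)
  then show ?case
    using * by (intro bexI[of _ "\<lambda>z. C z * C' z - S z * S' z"] bexI[of _ "\<lambda>z. S z * C' z + C z * S' z"]) auto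
qed

text \<open>Inputs have integer entries, so the weights enter only through
  \<open>cos (W j i)\<close> and \<open>sin (W j i)\<close>. Taking these as the variables makes
  every activation a polynomial with no pieces to select and denominator 1.\<close>

lemma trig_poly_growth:
  assumes "trig_poly_act K \<sigma>"
  shows "\<exists>\<kappa>. \<forall>p m d A. p \<ge> 1 \<longrightarrow> m \<ge> 1 \<longrightarrow> d \<ge> 1 \<longrightarrow> finite A \<longrightarrow> (\<forall>x\<in>A. (\<Sum>k<p. x k) = m) \<longrightarrow>
    finite (range (\<lambda>(W, V). restrict (predictor \<sigma> p d W V) A)) \<and>
    card (range (\<lambda>(W, V). restrict (predictor \<sigma> p d W V) A))
      \<le> ((31 + 12 * \<kappa>) * (d + p + m + card A) ^ 7) ^ (6 * (d * p))"
proof -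
  from assms obtain a0 and a b :: "nat \<Rightarrow> real" where
    \<sigma>: "\<And>t. \<sigma> t = a0 + (\<Sum>k=1..K. a k * cos (real k * t) + b k * sin (real k * t))"
    unfolding trig_poly_act_def by blast
  show ?thesis
  proof (rule exI[of _ K], intro allI impI)
    fix p m d :: nat and A :: "(nat \<Rightarrow> nat) set"
    assume h: "p \<ge> 1" "m \<ge> 1" "d \<ge> 1" "finite A" and m: "\<forall>x\<in>A. (\<Sum>k<p. x k) = m"
    let ?I = "param_index p d"
    define enc :: "(nat \<Rightarrow> nat \<Rightarrow> real) \<Rightarrow> (nat \<Rightarrow> nat \<Rightarrow> real) \<Rightarrow> nat \<times> nat \<times> nat \<Rightarrow> real" where
      "enc = (\<lambda>W V (t, j, i). if t = 0 then V i j else if t = 1 then cos (W j i) else sin (W j i))"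
    define R where "R x j H \<longleftrightarrow> (\<forall>W V. \<sigma> (\<Sum>i<p. W j i * real (x i)) = H (enc W V))" for x j H
    have "\<exists>H\<in>poly_fun ?I (K * (1 + m)). R x j H"
      if x: "x \<in> A" and j: "j < d" for x j
    proof -
      define Q where "Q k C S \<longleftrightarrow> (\<forall>W V. C (enc W V) = cos (real k * (\<Sum>i<p. W j i * real (x i))) \<and>
               S (enc W V) = sin (real k * (\<Sum>i<p. W j i * real (x i))))" for k C S
      have "\<exists>C S. C \<in> poly_fun ?I (K * (1 + m)) \<and> S \<in> poly_fun ?I (K * (1 + m)) \<and> Q k C S"
        if "k \<le> K" for k
      proof -
        obtain C S where C: "C \<in> poly_fun ?I (\<Sum>i<p. k * x i)" and S: "S \<in> poly_fun ?I (\<Sum>i<p. k * x i)"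
          and CS: "\<And>z w. \<forall>i<p. z (1, j, i) = cos (w i) \<and> z (2, j, i) = sin (w i) \<Longrightarrow>
            C z = cos (\<Sum>i<p. real (k * x i) * w i) \<and> S z = sin (\<Sum>i<p. real (k * x i) * w i)"
          using cos_sin_integer_combination_poly_fun[of ?I p "\<lambda>i. (1, j, i)" "\<lambda>i. (2, j, i)" "\<lambda>i. k * x i"] j
          by (auto simp: param_index_def)
        have "(\<Sum>i<p. k * x i) = k * m" using m x by (simp flip: sum_distrib_left)
        moreover have "k * m \<le> K * (1 + m)" using that by (intro mult_mono) auto
        ultimately have "C \<in> poly_fun ?I (K * (1 + m))" "S \<in> poly_fun ?I (K * (1 + m))"
          using C S by (auto intro: poly_fun_mono)
        moreover have "Q k C S"
          unfolding Q_def
        proof (intro allI)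
          fix W V
          show "C (enc W V) = cos (real k * (\<Sum>i<p. W j i * real (x i))) \<and>
            S (enc W V) = sin (real k * (\<Sum>i<p. W j i * real (x i)))"
            using CS[of "enc W V" "W j"] by (simp add: enc_def sum_distrib_left mult_ac)
        qed
        ultimately show ?thesis by blast
      qed
      then obtain C S where CS: "\<And>k. k \<le> K \<Longrightarrow> C k \<in> poly_fun ?I (K * (1 + m))"
          "\<And>k. k \<le> K \<Longrightarrow> S k \<in> poly_fun ?I (K * (1 + m))" "\<And>k. k \<le> K \<Longrightarrow> Q k (C k) (S k)"
        by metis
      show ?thesis unfolding R_def
      proof (rule bexI[of _ "\<lambda>z. a0 + (\<Sum>k=1..K. a k * C k z + b k * S k z)"])
        show "\<forall>W V. \<sigma> (\<Sum>i<p. W j i * real (x i)) = a0 + (\<Sum>k=1..K. a k * C k (enc W V) + b k * S k (enc W V))"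
          unfolding \<sigma> using CS(3) by (simp add: Q_def)
        show "(\<lambda>z. a0 + (\<Sum>k=1..K. a k * C k z + b k * S k z)) \<in> poly_fun ?I (K * (1 + m))"
          using CS(1,2) by (intro poly_fun_add poly_fun_const poly_fun_sum poly_fun_scale) auto
      qed
    qed
    then obtain H where H: "\<And>x j. x \<in> A \<Longrightarrow> j < d \<Longrightarrow> H x j \<in> poly_fun ?I (K * (1 + m))"
      "\<And>x j. x \<in> A \<Longrightarrow> j < d \<Longrightarrow> R x j (H x j)"
      by metis
    show "finite (range (\<lambda>(W, V). restrict (predictor \<sigma> p d W V) A)) \<and>
      card (range (\<lambda>(W, V). restrict (predictor \<sigma> p d W V) A))
        \<le> ((31 + 12 * K) * (d + p + m + card A) ^ 7) ^ (6 * (d * p))"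
    proof (rule card_predictor_restrictions_le[where ?K1.0 = "{} :: nat set" and g = "\<lambda>_ _. 0" and
          num = "\<lambda>_. H" and den = "\<lambda>x j z. 1" and enc = enc])
      show "\<sigma> (\<Sum>i<p. W j i * real (x i)) = H x j (enc W V) / 1" if "x \<in> A" "j < d" for W V x j
        using H(2)[OF that] by (simp add: R_def)
      show "enc W V (0, j, l) = V l j" for W V j l by (simp add: enc_def)
    qed (use h H(1) in \<open>auto intro: poly_fun_const\<close>)
  qed
qed

text \<open>The exponential of \<open>k\<close> times a preactivation is the monomial
  \<open>E\<close> in the quantities \<open>exp (k * W j i)\<close>, with the input entries as
  exponents. Treating these and \<open>W j i\<close> as separate variables makes each activation a
  quotient of polynomials, whose denominator is positive at encoded parameters because
  \<open>c\<close> is nonnegative and \<tau> positive.\<close>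

lemma pre_growth:
  assumes "pre_act \<sigma>"
  shows "\<exists>\<kappa>. \<forall>p m d A. p \<ge> 1 \<longrightarrow> m \<ge> 1 \<longrightarrow> d \<ge> 1 \<longrightarrow> finite A \<longrightarrow> (\<forall>x\<in>A. (\<Sum>k<p. x k) = m) \<longrightarrow>
    finite (range (\<lambda>(W, V). restrict (predictor \<sigma> p d W V) A)) \<and>
    card (range (\<lambda>(W, V). restrict (predictor \<sigma> p d W V) A))
      \<le> ((31 + 12 * \<kappa>) * (d + p + m + card A) ^ 7) ^ (6 * (d * p))"
proof -
  from assms obtain k c \<tau> a b :: real and P :: "real poly" where
    \<sigma>: "c \<ge> 0" "\<tau> > 0" "\<And>t. \<sigma> t = poly P t * ((a * exp (k * t) + b) / (c * exp (k * t) + \<tau>))"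
    unfolding pre_act_def by blast
  show ?thesis
  proof (rule exI[of _ "degree P + 1"], intro allI impI)
    fix p m d :: nat and A :: "(nat \<Rightarrow> nat) set"
    assume h: "p \<ge> 1" "m \<ge> 1" "d \<ge> 1" "finite A" and m: "\<forall>x\<in>A. (\<Sum>k<p. x k) = m"
    let ?I = "param_index p d"
    define enc :: "(nat \<Rightarrow> nat \<Rightarrow> real) \<Rightarrow> (nat \<Rightarrow> nat \<Rightarrow> real) \<Rightarrow> nat \<times> nat \<times> nat \<Rightarrow> real" where
      "enc = (\<lambda>W V (t, j, i). if t = 0 then V i j else if t = 1 then W j i else exp (k * W j i))"
    define pre where "pre x j z = (\<Sum>i<p. real (x i) * z (1, j, i))"
      for x :: "nat \<Rightarrow> nat" and j :: nat and z :: "nat \<times> nat \<times> nat \<Rightarrow> real"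
    define E where "E x j z = (\<Prod>i<p. z (2, j, i) ^ x i)"
      for x :: "nat \<Rightarrow> nat" and j :: nat and z :: "nat \<times> nat \<times> nat \<Rightarrow> real"
    have pre: "pre x j \<in> poly_fun ?I 1" if "j < d" for x j
      unfolding pre_def using that by (intro poly_fun_sum poly_fun_scale poly_fun_var) (auto simp: param_index_def)
    have E: "E x j \<in> poly_fun ?I m" if "x \<in> A" "j < d" for x j
    proof -
      have "E x j \<in> poly_fun ?I (\<Sum>i<p. x i * 1)"
        unfolding E_def using that by (intro poly_fun_prod poly_fun_power poly_fun_var) (auto simp: param_index_def)
      then show ?thesis using m that by simp
    qed
    have enc_pre: "pre x j (enc W V) = (\<Sum>i<p. W j i * real (x i))" for x j W V
      by (simp add: pre_def enc_def mult.commute)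
    have enc_E: "E x j (enc W V) = exp (k * (\<Sum>i<p. W j i * real (x i)))" for x j W V
      by (simp add: E_def enc_def sum_distrib_left exp_sum exp_of_nat_mult[symmetric] mult_ac)
    have num: "(\<lambda>z. poly P (pre x j z) * (a * E x j z + b)) \<in> poly_fun ?I ((degree P + 1) * (1 + m))"
      if "x \<in> A" "j < d" for x j
    proof (rule poly_fun_mono)
      show "(\<lambda>z. poly P (pre x j z) * (a * E x j z + b)) \<in> poly_fun ?I (degree P * 1 + m)"
        using that by (intro poly_fun_mult poly_fun_poly pre poly_fun_add poly_fun_scale E poly_fun_const) auto
    qed auto
    show "finite (range (\<lambda>(W, V). restrict (predictor \<sigma> p d W V) A)) \<and>
      card (range (\<lambda>(W, V). restrict (predictor \<sigma> p d W V) A))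
        \<le> ((31 + 12 * (degree P + 1)) * (d + p + m + card A) ^ 7) ^ (6 * (d * p))"
    proof (rule card_predictor_restrictions_le[where ?K1.0 = "{} :: nat set" and g = "\<lambda>_ _. 0" and
          num = "\<lambda>_ x j z. poly P (pre x j z) * (a * E x j z + b)" and den = "\<lambda>x j z. c * E x j z + \<tau>" and enc = enc])
      show "(\<lambda>z. c * E x j z + \<tau>) \<in> poly_fun ?I m" if "x \<in> A" "j < d" for x j
        using that by (intro poly_fun_add poly_fun_scale E poly_fun_const) auto
      show "c * E x j (enc W V) + \<tau> > 0" for W V x j
        unfolding enc_E using \<sigma>(1,2) by (intro add_nonneg_pos) auto
      show "\<sigma> (\<Sum>i<p. W j i * real (x i)) = poly P (pre x j (enc W V)) * (a * E x j (enc W V) + b) /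
          (c * E x j (enc W V) + \<tau>)" for W V x j
        unfolding \<sigma>(3) enc_pre enc_E by simp
      show "enc W V (0, j, l) = V l j" for W V j l by (simp add: enc_def)
      show "(\<lambda>z. poly P (pre x j z) * (a * E x j z + b)) \<in> poly_fun ?I ((degree P + 1) * (1 + m))"
        if "x \<in> A" "j < d" for x j using that by (rule num)
    qed (use h in auto)
  qed
qed

section \<open>The generalization bound\<close>

lemma finite_set_D_m:
  assumes "p \<ge> 1"
  shows "finite (set_pmf (D_m p m))"
    and "z \<in> set_pmf (D_m p m) \<Longrightarrow> (\<Sum>k<p. fst z k) = m"
proof -
  have ne: "PiE {..<m} (\<lambda>_. {..<p}) \<noteq> {}" using assms by (auto simp: PiE_eq_empty_iff lessThan_empty_iff)
  have fin: "finite (PiE {..<m} (\<lambda>_. {..<p}))" by (intro finite_PiE) auto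
  have set: "set_pmf (D_m p m) = (\<lambda>s. (data_X m s, data_Y p m s)) ` PiE {..<m} (\<lambda>_. {..<p})"
    unfolding D_m_def using set_pmf_of_set[OF ne fin] by simp
  then show "finite (set_pmf (D_m p m))" using fin by simp
  assume "z \<in> set_pmf (D_m p m)"
  then obtain s where s: "s \<in> PiE {..<m} (\<lambda>_. {..<p})" "fst z = data_X m s" unfolding set by auto
  have "(\<Sum>k<p. fst z k) = (\<Sum>k<p. \<Sum>i\<in>{i. i \<in> {..<m} \<and> s i = k}. 1)"
    by (simp add: s(2) data_X_def)
  also have "\<dots> = (\<Sum>i<m. 1)" using s(1) by (intro sum.group) auto
  finally show "(\<Sum>k<p. fst z k) = m" by simp
qed

lemma activation_growth:
  assumes "(\<exists>L r. L \<ge> 1 \<and> r \<ge> 1 \<and> piecewise_poly_act L r \<sigma>) \<or> (\<exists>K. trig_poly_act K \<sigma>) \<or> pre_act \<sigma>"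
  shows "\<exists>\<kappa>. \<forall>p m d A. p \<ge> 1 \<longrightarrow> m \<ge> 1 \<longrightarrow> d \<ge> 1 \<longrightarrow> finite A \<longrightarrow> (\<forall>x\<in>A. (\<Sum>k<p. x k) = m) \<longrightarrow>
    finite (range (\<lambda>(W, V). restrict (predictor \<sigma> p d W V) A)) \<and>
    card (range (\<lambda>(W, V). restrict (predictor \<sigma> p d W V) A))
      \<le> ((31 + 12 * \<kappa>) * (d + p + m + card A) ^ 7) ^ (6 * (d * p))"
proof -
  consider (pp) L r where "L \<ge> 1" "piecewise_poly_act L r \<sigma>" | (tp) K where "trig_poly_act K \<sigma>" | (pre) "pre_act \<sigma>"
    using assms by blast
  then show ?thesis
  proof cases
    case pp
    then show ?thesis using piecewise_poly_growth[of L r \<sigma>] by metis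
  next
    case tp
    then show ?thesis by (rule trig_poly_growth)
  next
    case pre
    then show ?thesis by (rule pre_growth)
  qed
qed

definition loss :: "(real \<Rightarrow> real) \<Rightarrow> nat \<Rightarrow> nat \<Rightarrow> (nat \<Rightarrow> nat \<Rightarrow> real) \<Rightarrow> (nat \<Rightarrow> nat \<Rightarrow> real) \<Rightarrow>
    (nat \<Rightarrow> nat) \<times> nat \<Rightarrow> real" where
  "loss \<sigma> p d W V z = (if predictor \<sigma> p d W V (fst z) \<noteq> Some (snd z) then 1 else 0)"

lemma expectation_loss:
  "measure_pmf.expectation D (loss \<sigma> p d W V) =
    measure_pmf.prob D {(x, y). predictor \<sigma> p d W V x \<noteq> Some y}"
proof -
  have "loss \<sigma> p d W V = indicat_real {(x, y). predictor \<sigma> p d W V x \<noteq> Some y}"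
    by (auto simp: loss_def indicator_def fun_eq_iff)
  then show ?thesis by simp
qed

text \<open>The loss at a labelled point depends on the parameters only through the predictor at its
  input, so loss patterns on \<open>Z\<close> are no more numerous than predictor patterns on the
  inputs in \<open>Z\<close>. The sign \<open>s\<close> yields both one-sided deviations from the
  one-sided symmetrization bound.\<close>

lemma loss_deviation:
  fixes s \<epsilon> G :: real
  assumes p: "p \<ge> 1" and n: "n \<ge> 1" and \<epsilon>: "\<epsilon> \<ge> 0" and s: "\<bar>s\<bar> = 1"
    and growth: "\<And>A. finite A \<Longrightarrow> card A \<le> 2 * n \<Longrightarrow> (\<And>x. x \<in> A \<Longrightarrow> (\<Sum>k<p. x k) = m) \<Longrightarrow>
      finite (range (\<lambda>(W, V). restrict (predictor \<sigma> p d W V) A)) \<and>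
      real (card (range (\<lambda>(W, V). restrict (predictor \<sigma> p d W V) A))) \<le> G"
  shows "measure_pmf.prob (D_m_n p m n) {S. \<exists>W V. s * (measure_pmf.expectation (D_m p m) (loss \<sigma> p d W V)
      - (1 / real n) * (\<Sum>i<n. loss \<sigma> p d W V (S i))) > \<epsilon>} \<le> G * exp (- (real n * \<epsilon>\<^sup>2 / 2))"
proof -
  define F where "F = range (\<lambda>(W, V) z. s * loss \<sigma> p d W V z)"
  have fin: "finite (set_pmf (D_m p m))" by (rule finite_set_D_m[OF p])
  have "measure_pmf.prob (Pi_pmf {..<n} undefined (\<lambda>_. D_m p m))
      {S. \<exists>f\<in>F. measure_pmf.expectation (D_m p m) f - (1 / real n) * (\<Sum>i<n. f (S i)) > \<epsilon>}
    \<le> G * exp (- (real n * \<epsilon>\<^sup>2 / 2))"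
  proof (rule symmetrization_bound[OF n fin \<epsilon>])
    show "\<bar>f z' - f z\<bar> \<le> 1" if "f \<in> F" for f z z'
      using that s by (auto simp: F_def loss_def)
    fix Z assume Z: "Z \<subseteq> set_pmf (D_m p m)" "card Z \<le> 2 * n"
    define A where "A = fst ` Z"
    have finZ: "finite Z" using Z fin finite_subset by blast
    then have A: "finite A" "card A \<le> 2 * n"
      using Z(2) card_image_le[OF finZ, of fst] by (auto simp: A_def)
    have "(\<Sum>k<p. x k) = m" if "x \<in> A" for x
      using that Z(1) finite_set_D_m(2)[OF p] by (auto simp: A_def)
    then have G: "finite (range (\<lambda>(W, V). restrict (predictor \<sigma> p d W V) A))"
      "real (card (range (\<lambda>(W, V). restrict (predictor \<sigma> p d W V) A))) \<le> G"
      using growth[OF A] by auto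
    have "(\<lambda>f. restrict f Z) ` F = range (\<lambda>(W, V). restrict (\<lambda>z. s * loss \<sigma> p d W V z) Z)"
      by (auto simp: F_def image_image case_prod_unfold)
    moreover have "finite (range (\<lambda>(W, V). restrict (\<lambda>z. s * loss \<sigma> p d W V z) Z)) \<and>
        card (range (\<lambda>(W, V). restrict (\<lambda>z. s * loss \<sigma> p d W V z) Z)) \<le>
        card (range (\<lambda>(W, V). restrict (predictor \<sigma> p d W V) A))"
    proof (rule card_range_determined_le[OF G(1) subset_refl])
      fix a b :: "(nat \<Rightarrow> nat \<Rightarrow> real) \<times> (nat \<Rightarrow> nat \<Rightarrow> real)"
      obtain W V W' V' where ab: "a = (W, V)" "b = (W', V')" by (cases a, cases b)
      assume "(\<lambda>(W, V). restrict (predictor \<sigma> p d W V) A) a = (\<lambda>(W, V). restrict (predictor \<sigma> p d W V) A) b"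
      then have "predictor \<sigma> p d W V x = predictor \<sigma> p d W' V' x" if "x \<in> A" for x
        using that unfolding ab by (auto dest!: fun_cong[of _ _ x])
      then have "loss \<sigma> p d W V z = loss \<sigma> p d W' V' z" if "z \<in> Z" for z
        using that by (simp add: A_def loss_def)
      then show "(\<lambda>(W, V). restrict (\<lambda>z. s * loss \<sigma> p d W V z) Z) a = (\<lambda>(W, V). restrict (\<lambda>z. s * loss \<sigma> p d W V z) Z) b"
        unfolding ab by (auto simp: restrict_def fun_eq_iff)
    qed
    ultimately show "finite ((\<lambda>f. restrict f Z) ` F) \<and> real (card ((\<lambda>f. restrict f Z) ` F)) \<le> G"
      using G(2) by auto
  qed
  moreover have "{S. \<exists>f\<in>F. measure_pmf.expectation (D_m p m) f - (1 / real n) * (\<Sum>i<n. f (S i)) > \<epsilon>} =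
    {S. \<exists>W V. s * (measure_pmf.expectation (D_m p m) (loss \<sigma> p d W V)
      - (1 / real n) * (\<Sum>i<n. loss \<sigma> p d W V (S i))) > \<epsilon>}"
    by (simp add: F_def sum_distrib_left[symmetric] algebra_simps)
  ultimately show ?thesis by (simp add: D_m_n_def)
qed

text \<open>\<open>C\<close> and \<open>q\<close> are chosen after the activation but before all
  other parameters, as the soft-O notation demands. The summand \<open>exp 1\<close> keeps the
  logarithm at least 1.\<close>

theorem mainTheorem5:
  fixes \<sigma> :: "real \<Rightarrow> real"
  assumes act: "(\<exists>L r. L \<ge> 1 \<and> r \<ge> 1 \<and> piecewise_poly_act L r \<sigma>)
              \<or> (\<exists>K. trig_poly_act K \<sigma>) \<or> pre_act \<sigma>"
  shows "\<exists>(C::real) (q::nat). \<forall>(p::nat) (m::nat) (d::nat) (n::nat) (\<delta>::real).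
           p \<ge> 2 \<longrightarrow> m \<ge> 1 \<longrightarrow> d \<ge> 1 \<longrightarrow> n \<ge> 1 \<longrightarrow> 0 < \<delta> \<longrightarrow> \<delta> < 1 \<longrightarrow>
           measure_pmf.prob (D_m_n p m n)
             {S. \<forall>W V.
                 \<bar>measure_pmf.prob (D_m p m) {(x, y). predictor \<sigma> p d W V x \<noteq> Some y}
                  - (1 / real n) * (\<Sum>i<n. (if predictor \<sigma> p d W V (fst (S i)) \<noteq> Some (snd (S i))
                                             then 1 else 0))\<bar>
                 \<le> C * (ln (exp 1 + real d + real p + real m + real n + 1 / \<delta>)) ^ q
                       * sqrt ((real d * real p + ln (1 / \<delta>)) / real n)}
           \<ge> 1 - \<delta>"
proof -
  from activation_growth[OF act] obtain \<kappa> where \<kappa>: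
    "\<And>p m d A. p \<ge> 1 \<Longrightarrow> m \<ge> 1 \<Longrightarrow> d \<ge> 1 \<Longrightarrow> finite A \<Longrightarrow> (\<forall>x\<in>A. (\<Sum>k<p. x k) = m) \<Longrightarrow>
    finite (range (\<lambda>(W, V). restrict (predictor \<sigma> p d W V) A)) \<and>
    card (range (\<lambda>(W, V). restrict (predictor \<sigma> p d W V) A))
      \<le> ((31 + 12 * \<kappa>) * (d + p + m + card A) ^ 7) ^ (6 * (d * p))" by blast
  define \<kappa>' where "\<kappa>' = real (31 + 12 * \<kappa>)"
  have \<kappa>': "\<kappa>' \<ge> 1" by (simp add: \<kappa>'_def)
  \<comment> \<open>Chosen so that \<open>ln (\<kappa>' * (2 * u) ^ 7)\<close> is at most
    \<open>c * L\<close> below, using that \<open>L\<close> is at least 1.\<close>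
  define c where "c = ln \<kappa>' + 7 * ln 2 + 7"
  have c: "c \<ge> 0" unfolding c_def using \<kappa>' by (intro add_nonneg_nonneg) auto
  define C where "C = 2 * (1 + 6 * c)"
  show ?thesis
  proof (rule exI[of _ C], rule exI[of _ 1], intro allI impI)
    fix p m d n :: nat and \<delta> :: real
    assume h: "p \<ge> 2" "m \<ge> 1" "d \<ge> 1" "n \<ge> 1" "0 < \<delta>" "\<delta> < 1"
    define u where "u = exp 1 + real d + real p + real m + real n + 1 / \<delta>"
    define L where "L = ln u"
    define T where "T = real d * real p + ln (1 / \<delta>)"
    define \<epsilon> where "\<epsilon> = C * L * sqrt (T / real n)"
    \<comment> \<open>The factor 2 absorbs the up to \<open>2 * n\<close> inputs of the sample and
      its ghost: \<open>d + p + m + 2 * n\<close> is at most \<open>2 * u\<close>.\<close>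
    define G where "G = (\<kappa>' * (2 * u) ^ 7) ^ (6 * (d * p))"
    have ule: "exp 1 \<le> u" "real d + real p + real m + 2 * real n \<le> 2 * u" using h by (auto simp: u_def)
    have u: "u > 0" using ule(1) exp_gt_zero[of "1::real"] by linarith
    have L: "L \<ge> 1" unfolding L_def using ule(1) u by (simp add: ln_ge_iff)
    have ln\<delta>: "ln (1 / \<delta>) > 0" using h by (intro ln_gt_zero) auto
    have "1 * 1 \<le> real d * real p" using h by (intro mult_mono) auto
    then have dp: "1 \<le> real d * real p" by simp
    have T: "T \<ge> 1" unfolding T_def using dp ln\<delta> by simp
    have \<epsilon>: "\<epsilon> \<ge> 0" unfolding \<epsilon>_def using L T c by (auto simp: C_def)
    have G0: "G > 0" unfolding G_def using u \<kappa>' by auto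
    have lnG: "ln G \<le> 6 * (real d * real p) * (c * L)"
    proof -
      have "ln G = real (6 * (d * p)) * ln (\<kappa>' * (2 * u) ^ 7)"
        unfolding G_def using u \<kappa>' by (simp only: ln_realpow)
      also have "ln (\<kappa>' * (2 * u) ^ 7) = ln \<kappa>' + ln ((2 * u) ^ 7)"
        using u \<kappa>' by (intro ln_mult_pos) auto
      also have "ln ((2 * u) ^ 7) = real 7 * ln (2 * u)" using u by (simp only: ln_realpow)
      also have "ln (2 * u) = ln 2 + L" unfolding L_def using u by (intro ln_mult_pos) auto
      also have "real (6 * (d * p)) * (ln \<kappa>' + real 7 * (ln 2 + L)) = 6 * (real d * real p) * (ln \<kappa>' + 7 * (ln 2 + L))"
        by simp
      also have "\<dots> \<le> 6 * (real d * real p) * (c * L)"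
      proof (intro mult_left_mono)
        have "ln \<kappa>' * 1 \<le> ln \<kappa>' * L" "ln 2 * 1 \<le> ln (2::real) * L"
          using L \<kappa>' by (intro mult_left_mono; simp)+
        then show "ln \<kappa>' + 7 * (ln 2 + L) \<le> c * L" unfolding c_def distrib_right distrib_left by linarith
      qed auto
      finally show ?thesis .
    qed
    \<comment> \<open>The logarithmic form of the requirement that each one-sided failure has
      probability at most \<open>\<delta> / 2\<close>. The left side is at most
      \<open>(1 + 6 * c) * (L * T)\<close>, the right side equals
      \<open>2 * (1 + 6 * c)\<^sup>2 * L\<^sup>2 * T\<close>.\<close>
    have exponent: "ln 2 + ln G + ln (1 / \<delta>) \<le> real n * \<epsilon>\<^sup>2 / 2"
    proof -
      have "ln (2::real) \<le> real d * real p" using dp ln_le_minus_one[of "2::real"] by simp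
      then have "ln 2 + ln G + ln (1 / \<delta>) \<le> T + 6 * (real d * real p) * (c * L)"
        using lnG by (simp add: T_def)
      also have "\<dots> \<le> T * L + 6 * T * (c * L)"
      proof (intro add_mono mult_right_mono mult_left_mono)
        show "T \<le> T * L" using T L by (simp add: mult_le_cancel_left1)
        show "real d * real p \<le> T" using ln\<delta> by (simp add: T_def)
      qed (use c L in auto)
      also have "\<dots> = (1 + 6 * c) * (L * T)" by (simp add: algebra_simps)
      also have "\<dots> \<le> (2 * (1 + 6 * c) * (1 + 6 * c)) * (L * L * T)"
      proof (intro mult_mono)
        have "1 + 6 * c \<le> (1 + 6 * c) * (2 * (1 + 6 * c))" using c by (intro mult_le_cancel_left1[THEN iffD2]) auto
        then show "1 + 6 * c \<le> 2 * (1 + 6 * c) * (1 + 6 * c)" by (simp add: mult_ac)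
        show "L \<le> L * L" using L by (simp add: mult_le_cancel_left1)
      qed (use c L T in auto)
      also have "\<dots> = C\<^sup>2 * L\<^sup>2 * T / 2" by (simp add: C_def power2_eq_square algebra_simps)
      also have "\<dots> = real n * \<epsilon>\<^sup>2 / 2"
      proof -
        have "(sqrt (T / real n))\<^sup>2 = T / real n" using T by simp
        then have "\<epsilon>\<^sup>2 = C\<^sup>2 * L\<^sup>2 * (T / real n)" unfolding \<epsilon>_def power_mult_distrib by simp
        then show ?thesis using h by simp
      qed
      finally show ?thesis .
    qed
    have tail: "G * exp (- (real n * \<epsilon>\<^sup>2 / 2)) \<le> \<delta> / 2"
    proof -
      have "G * exp (- (real n * \<epsilon>\<^sup>2 / 2)) = exp (ln G - real n * \<epsilon>\<^sup>2 / 2)"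
        unfolding diff_conv_add_uminus exp_add using G0 by simp
      also have "\<dots> \<le> exp (- ln 2 - ln (1 / \<delta>))" using exponent by simp
      also have "\<dots> = \<delta> / 2"
        unfolding exp_diff exp_minus using h by simp
      finally show ?thesis .
    qed
    have growth: "finite (range (\<lambda>(W, V). restrict (predictor \<sigma> p d W V) A)) \<and>
      real (card (range (\<lambda>(W, V). restrict (predictor \<sigma> p d W V) A))) \<le> G"
      if A: "finite A" "card A \<le> 2 * n" "\<And>x. x \<in> A \<Longrightarrow> (\<Sum>k<p. x k) = m" for A
    proof -
      have *: "finite (range (\<lambda>(W, V). restrict (predictor \<sigma> p d W V) A))"
        "card (range (\<lambda>(W, V). restrict (predictor \<sigma> p d W V) A))
          \<le> ((31 + 12 * \<kappa>) * (d + p + m + card A) ^ 7) ^ (6 * (d * p))"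
        using \<kappa>[of p m d A] h A by auto
      have "real (card (range (\<lambda>(W, V). restrict (predictor \<sigma> p d W V) A)))
          \<le> real (((31 + 12 * \<kappa>) * (d + p + m + card A) ^ 7) ^ (6 * (d * p)))"
        using *(2) by (rule of_nat_mono)
      also have "\<dots> = (\<kappa>' * real (d + p + m + card A) ^ 7) ^ (6 * (d * p))"
        by (simp only: \<kappa>'_def of_nat_power of_nat_mult)
      also have "\<dots> \<le> G"
        unfolding G_def using ule(2) A(2) \<kappa>' by (intro power_mono mult_left_mono) auto
      finally show ?thesis using *(1) by simp
    qed
    define dev where "dev W V S = measure_pmf.expectation (D_m p m) (loss \<sigma> p d W V)
      - (1 / real n) * (\<Sum>i<n. loss \<sigma> p d W V (S i))" for W V S
    have bad: "measure_pmf.prob (D_m_n p m n) {S. \<exists>W V. s * dev W V S > \<epsilon>} \<le> \<delta> / 2" if "\<bar>s\<bar> = 1" for s :: real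
      unfolding dev_def
      by (rule order_trans[OF loss_deviation[OF _ \<open>n \<ge> 1\<close> \<epsilon> that growth] tail]) (use h in auto)
    let ?P = "measure_pmf.prob (D_m_n p m n)"
    have "1 = ?P UNIV" by simp
    \<comment> \<open>Union bound: a sample is either good or fails on one of the two sides.\<close>
    also have "\<dots> \<le> ?P ({S. \<forall>W V. \<bar>dev W V S\<bar> \<le> \<epsilon>} \<union>
        ({S. \<exists>W V. 1 * dev W V S > \<epsilon>} \<union> {S. \<exists>W V. - 1 * dev W V S > \<epsilon>}))"
    proof (intro measure_pmf.finite_measure_mono subsetI)
      fix S
      have "\<bar>dev W V S\<bar> \<le> \<epsilon> \<or> 1 * dev W V S > \<epsilon> \<or> - 1 * dev W V S > \<epsilon>" for W V by linarith
      then show "S \<in> {S. \<forall>W V. \<bar>dev W V S\<bar> \<le> \<epsilon>} \<union>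
          ({S. \<exists>W V. 1 * dev W V S > \<epsilon>} \<union> {S. \<exists>W V. - 1 * dev W V S > \<epsilon>})" by blast
    qed simp
    also have "\<dots> \<le> ?P {S. \<forall>W V. \<bar>dev W V S\<bar> \<le> \<epsilon>} +
        (?P {S. \<exists>W V. 1 * dev W V S > \<epsilon>} + ?P {S. \<exists>W V. - 1 * dev W V S > \<epsilon>})"
      by (intro order_trans[OF measure_Un_le] add_left_mono) auto
    also have "\<dots> \<le> ?P {S. \<forall>W V. \<bar>dev W V S\<bar> \<le> \<epsilon>} + (\<delta> / 2 + \<delta> / 2)"
      by (intro add_mono bad order_refl) auto
    finally have "1 - \<delta> \<le> ?P {S. \<forall>W V. \<bar>dev W V S\<bar> \<le> \<epsilon>}" by simp
    then show "measure_pmf.prob (D_m_n p m n)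
             {S. \<forall>W V.
                 \<bar>measure_pmf.prob (D_m p m) {(x, y). predictor \<sigma> p d W V x \<noteq> Some y}
                  - (1 / real n) * (\<Sum>i<n. (if predictor \<sigma> p d W V (fst (S i)) \<noteq> Some (snd (S i))
                                             then 1 else 0))\<bar>
                 \<le> C * (ln (exp 1 + real d + real p + real m + real n + 1 / \<delta>)) ^ 1
                       * sqrt ((real d * real p + ln (1 / \<delta>)) / real n)}
           \<ge> 1 - \<delta>"
      unfolding dev_def expectation_loss unfolding loss_def \<epsilon>_def L_def u_def T_def by simp
  qed
qed

end
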